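(* Let $G(\tau)=\eta^6(\tau)\Big/\Big(\theta\begin{bmatrix}3/5\\3/5\end{bmatrix}(0,\tau)\,\theta\begin{bmatrix}3/5\\7/5\end{bmatrix}(0,\tau)\Big)$. For every $M=\begin{pmatrix} a&b\\ c&d\end{pmatrix}\in\Gamma_{\theta,5}$, $G(M\tau)=\nu_G(M)(c\tau+d)^2G(\tau)$ with $\nu_G(M)=\exp\!\left(\frac{\pi i}{5}g(M)\right)$, where $g(M)=\frac{6b}{5}+\frac{2ab}{5}+\frac{2cd}{5}$ if $M\equiv I\pmod5$; $g(M)=\frac{24b}{5}+\frac{2ab}{5}+\frac{2cd}{5}$ if $M\equiv -I\pmod5$; $g(M)=5+\frac{6d}{5}+\frac{2ab}{5}+\frac{2cd}{5}$ if $M\equiv\begin{pmatrix}0&-1\\1&0\end{pmatrix}\pmod5$; $g(M)=5-\frac{6d}{5}+\frac{2ab}{5}+\frac{2cd}{5}$ if $M\equiv\begin{pmatrix}0&1\\-1&0\end{pmatrix}\pmod5$.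
   Context: $\mathscr{H}$ is the upper half plane, $M\tau=\frac{a\tau+b}{c\tau+d}$, $I$ the identity matrix. $\theta\begin{bmatrix}\epsilon\\ \epsilon'\end{bmatrix}(v,\tau)=\sum_{n\in\mathbb{Z}}\exp\!\Big(2\pi i\Big[\tfrac12\big(n+\tfrac{\epsilon}{2}\big)^2\tau+\big(n+\tfrac{\epsilon}{2}\big)\big(v+\tfrac{\epsilon'}{2}\big)\Big]\Big)$. $\eta(\tau)=q^{1/24}\prod_{n\ge1}(1-q^n)$, $q=e^{2\pi i\tau}$. $\Gamma_{\theta,5}=\{M\in SL(2,\mathbb{Z}): M\equiv\pm\begin{pmatrix}1&0\\0&1\end{pmatrix}\text{ or }\pm\begin{pmatrix}0&-1\\1&0\end{pmatrix}\pmod 5\}$. *)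

theory Defs
  imports "HOL-Analysis.Analysis" "HOL-Number_Theory.Number_Theory"
begin

definition theta_char :: "real \<Rightarrow> real \<Rightarrow> complex \<Rightarrow> complex \<Rightarrow> complex" where
  "theta_char eps eps' v \<tau> =
     (\<Sum>\<^sub>\<infinity> n::int. exp (2 * pi * \<i> *
        ((1/2) * (of_int n + of_real eps / 2)^2 * \<tau>
         + (of_int n + of_real eps / 2) * (v + of_real eps' / 2))))"

definition dedekind_eta :: "complex \<Rightarrow> complex" where
  "dedekind_eta \<tau> = exp (2 * pi * \<i> * \<tau> / 24) *
     (\<Prod>n. (1 - exp (2 * pi * \<i> * \<tau>) ^ Suc n))"

definition G_fun :: "complex \<Rightarrow> complex" where
  "G_fun \<tau> = dedekind_eta \<tau> ^ 6 /
     (theta_char (3/5) (3/5) 0 \<tau> * theta_char (3/5) (7/5) 0 \<tau>)"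

definition in_Gamma_theta5 :: "int \<Rightarrow> int \<Rightarrow> int \<Rightarrow> int \<Rightarrow> bool" where
  "in_Gamma_theta5 a b c d \<longleftrightarrow> a * d - b * c = 1 \<and>
     (([a = 1] (mod 5) \<and> [b = 0] (mod 5) \<and> [c = 0] (mod 5) \<and> [d = 1] (mod 5)) \<or>
      ([a = -1] (mod 5) \<and> [b = 0] (mod 5) \<and> [c = 0] (mod 5) \<and> [d = -1] (mod 5)) \<or>
      ([a = 0] (mod 5) \<and> [b = -1] (mod 5) \<and> [c = 1] (mod 5) \<and> [d = 0] (mod 5)) \<or>
      ([a = 0] (mod 5) \<and> [b = 1] (mod 5) \<and> [c = -1] (mod 5) \<and> [d = 0] (mod 5)))"

definition g_exp :: "int \<Rightarrow> int \<Rightarrow> int \<Rightarrow> int \<Rightarrow> real" where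
  "g_exp a b c d =
     (if [a = 1] (mod 5) \<and> [b = 0] (mod 5) \<and> [c = 0] (mod 5) \<and> [d = 1] (mod 5)
      then 6 * b / 5 + 2 * a * b / 5 + 2 * c * d / 5
      else if [a = -1] (mod 5) \<and> [b = 0] (mod 5) \<and> [c = 0] (mod 5) \<and> [d = -1] (mod 5)
      then 24 * b / 5 + 2 * a * b / 5 + 2 * c * d / 5
      else if [a = 0] (mod 5) \<and> [b = -1] (mod 5) \<and> [c = 1] (mod 5) \<and> [d = 0] (mod 5)
      then 5 + 6 * d / 5 + 2 * a * b / 5 + 2 * c * d / 5
      else 5 - 6 * d / 5 + 2 * a * b / 5 + 2 * c * d / 5)"

definition nu_G :: "int \<Rightarrow> int \<Rightarrow> int \<Rightarrow> int \<Rightarrow> complex" where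
  "nu_G a b c d = exp (pi * \<i> / 5 * of_real (g_exp a b c d))"

end

(* Up to a constant, G is 1 / (K(1/5, 1/5) K(1/5, -1/5)) for the Klein forms K(r, s), since by the
   Jacobi triple product every theta constant is eta^3 times a Klein form.  A Klein form satisfies
   K(r, s)(M tau) = K((r, s) M)(tau) / (c tau + d) for all M in SL(2, Z) without any multiplier:
   both sides come from entire functions of z = r tau + s with the same quasi-periods, the same
   simple zeros and the same derivative at 0, hence are equal by Liouville's theorem.  For M in the
   group at hand, (r, s) M returns to (1/5, 1/5) or (1/5, -1/5) up to sign and an integral shift,
   and nu_G collects the resulting tenth roots of unity. *)
theory Submission
  imports Defs "HOL-Complex_Analysis.Complex_Analysis"
begin

section \<open>The $q$-Pochhammer symbol and the Jacobi triple product\<close>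

text \<open>Each of the two theta constants carries one factor eta^3, so \<open>eta^6\<close> is
  used up exactly. Since a Klein form has weight -1, the reciprocal of two of them has weight 2. The
  characteristics enter through \<open>1 - 2 * r\<close> and \<open>1 - 2 * s\<close>: 3/5 means
  1/5, and 7/5 means -1/5. Modulo 5, the matrices of the group are precisely those of determinant 1
  that permute the four vectors +-(1, 1), +-(1, -1); this is what makes the product of the two Klein
  forms return to itself.

  Arguing by uniqueness treats an arbitrary M in one go, with no decomposition into generators and
  no cocycle to track. The price is that the zeros must be known exactly, so the function is
  introduced as an infinite product, and the theta series meets it only through the triple product.
  Normalising the derivative at 0 to a value independent of \<tau> leaves no undetermined constant
  in the transformation law.\<close>

definition qpoch :: "complex \<Rightarrow> complex \<Rightarrow> complex" where
  "qpoch q x = (\<Prod>n. 1 - q ^ n * x)"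

lemma convergent_prod_qpoch:
  fixes q x :: complex
  assumes "norm q < 1"
  shows "convergent_prod (\<lambda>n. 1 - q ^ n * x)"
proof -
  have "summable (\<lambda>n. norm x * norm q ^ n)"
    using assms by (intro summable_mult summable_geometric) auto
  moreover have "norm ((1 - q ^ n * x) - 1) = norm x * norm q ^ n" for n
    by (simp add: norm_mult norm_power mult.commute)
  ultimately have "summable (\<lambda>n. norm ((1 - q ^ n * x) - 1))"
    by (simp only:)
  then show ?thesis
    using abs_convergent_prod_conv_summable abs_convergent_prod_imp_convergent_prod by blast
qed

lemma qpoch_LIMSEQ:
  assumes "norm q < 1"
  shows "(\<lambda>N. \<Prod>n<N. 1 - q ^ n * x) \<longlonglongrightarrow> qpoch q x"
  using convergent_prod_LIMSEQ[OF convergent_prod_qpoch[OF assms]]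
  unfolding qpoch_def LIMSEQ_lessThan_iff_atMost .

lemma qpoch_rec:
  assumes "norm q < 1"
  shows "qpoch q x = (1 - x) * qpoch q (q * x)"
proof -
  have "(\<lambda>N. \<Prod>n<Suc N. 1 - q ^ n * x) \<longlonglongrightarrow> qpoch q x"
    by (rule LIMSEQ_Suc[OF qpoch_LIMSEQ[OF assms]])
  moreover have "(\<lambda>N. (1 - x) * (\<Prod>n<N. 1 - q ^ n * (q * x))) \<longlonglongrightarrow> (1 - x) * qpoch q (q * x)"
    by (intro tendsto_intros qpoch_LIMSEQ assms)
  moreover have "(\<Prod>n<Suc N. 1 - q ^ n * x) = (1 - x) * (\<Prod>n<N. 1 - q ^ n * (q * x))" for N
    by (subst prod.lessThan_Suc_shift) (simp add: mult_ac)
  ultimately show ?thesis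
    using LIMSEQ_unique by simp
qed

lemma qpoch_eq_0_iff:
  assumes "norm q < 1"
  shows "qpoch q x = 0 \<longleftrightarrow> (\<exists>n. q ^ n * x = 1)"
proof -
  have "(\<lambda>n. 1 - q ^ n * x) has_prod qpoch q x"
    unfolding qpoch_def using convergent_prod_has_prod convergent_prod_qpoch[OF assms] by blast
  from has_prod_eq_0_iff[OF this] show ?thesis
    by (auto simp: image_iff)
qed

lemma qpoch_self_nonzero:
  assumes "norm q < 1"
  shows "qpoch q q \<noteq> 0"
proof
  assume "qpoch q q = 0"
  then obtain n where "q ^ Suc n = 1"
    using qpoch_eq_0_iff[OF assms] by (auto simp: mult.commute)
  then have "norm q ^ Suc n = 1"
    by (metis norm_one norm_power)
  then show False
    using assms power_Suc_le_self[of "norm q" n] by simp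
qed

lemma holomorphic_qpoch:
  assumes "norm q < 1"
  shows "qpoch q holomorphic_on UNIV"
proof (rule holomorphic_uniform_sequence)
  show "(\<lambda>x. \<Prod>n<N. 1 - q ^ n * x) holomorphic_on UNIV" for N
    by (intro holomorphic_intros)
next
  fix x0 :: complex
  let ?A = "cball x0 1"
  have "uniformly_convergent_on ?A (\<lambda>N x. \<Sum>n<N. norm ((1 - q ^ n * x) - 1))"
  proof (rule Weierstrass_m_test')
    show "norm (norm ((1 - q ^ n * x) - 1)) \<le> norm q ^ n * (norm x0 + 1)" if "x \<in> ?A" for n x
    proof -
      have "norm x \<le> norm x0 + 1"
        using that norm_triangle_sub[of x x0] by (simp add: dist_norm norm_minus_commute)
      then show ?thesis
        by (simp add: norm_mult norm_power mult_left_mono)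
    qed
    show "summable (\<lambda>n. norm q ^ n * (norm x0 + 1))"
      using assms by (intro summable_mult2 summable_geometric) auto
  qed
  then have "uniformly_convergent_on ?A (\<lambda>N x. \<Prod>n<N. 1 - q ^ n * x)"
    by (intro uniformly_convergent_on_prod') (auto intro!: continuous_intros)
  then obtain g where g: "uniform_limit ?A (\<lambda>N x. \<Prod>n<N. 1 - q ^ n * x) g sequentially"
    by (auto simp: uniformly_convergent_on_def)
  have "g x = qpoch q x" if "x \<in> ?A" for x
    using tendsto_uniform_limitI[OF g that] qpoch_LIMSEQ[OF assms] LIMSEQ_unique by blast
  then have "uniform_limit ?A (\<lambda>N x. \<Prod>n<N. 1 - q ^ n * x) (qpoch q) sequentially"
    using g by (metis (no_types, lifting) uniform_limit_cong')
  then show "\<exists>d. 0 < d \<and> cball x0 d \<subseteq> UNIV \<and>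
      uniform_limit (cball x0 d) (\<lambda>N x. \<Prod>n<N. 1 - q ^ n * x) (qpoch q) sequentially"
    by (intro exI[of _ 1]) auto
qed auto

lemma inverse_qpoch_partial_LIMSEQ:
  assumes "norm q < 1"
  shows "(\<lambda>N. inverse (\<Prod>n<N. 1 - q ^ n * q)) \<longlonglongrightarrow> inverse (qpoch q q)"
  by (intro tendsto_inverse qpoch_LIMSEQ qpoch_self_nonzero assms)

section \<open>Gaussian binomials and the finite triple product\<close>

text \<open>The reciprocal of the finite product \<open>(q; q)\<^sub>m\<close>, set to \<open>0\<close> for \<open>m < 0\<close>, so that the
  recurrence holds at every integer and the Gaussian binomials need no boundary cases.\<close>

definition rqfact :: "complex \<Rightarrow> int \<Rightarrow> complex" where
  "rqfact q m = (if m < 0 then 0 else inverse (\<Prod>n<nat m. 1 - q ^ n * q))"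

text \<open>At \<open>m = 0\<close> the factor \<open>1 - q powi m\<close> vanishes, which agrees
  with the value 0 chosen at -1.\<close>

lemma rqfact_rec:
  assumes "norm q < 1" "q \<noteq> 0"
  shows "rqfact q (m - 1) = (1 - q powi m) * rqfact q m"
proof -
  consider "m < 0" | "m = 0" | "m > 0" by linarith
  then show ?thesis
  proof cases
    case 3
    define k where "k = nat (m - 1)"
    have m: "m = int (Suc k)" using 3 by (simp add: k_def)
    have "q ^ k * q \<noteq> 1"
    proof
      assume "q ^ k * q = 1"
      then have "qpoch q q = 0" using qpoch_eq_0_iff[OF assms(1)] by auto
      then show False using qpoch_self_nonzero[OF assms(1)] by simp
    qed
    moreover have "q powi m = q ^ k * q"
      unfolding m by (simp only: power_int_of_nat power_Suc2)
    moreover have "rqfact q (m - 1) = inverse (\<Prod>n<k. 1 - q ^ n * q)"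
      by (simp add: rqfact_def m)
    moreover have "rqfact q m = inverse ((\<Prod>n<k. 1 - q ^ n * q) * (1 - q ^ k * q))"
      by (simp add: rqfact_def m nat_add_distrib)
    ultimately show ?thesis
      by simp
  qed (auto simp: rqfact_def)
qed

text \<open>The Gaussian binomial coefficient of \<open>2n\<close> over \<open>n + k\<close>.\<close>

definition qcentral :: "complex \<Rightarrow> nat \<Rightarrow> int \<Rightarrow> complex" where
  "qcentral q n k = (\<Prod>j<2*n. 1 - q ^ j * q) * rqfact q (int n + k) * rqfact q (int n - k)"

text \<open>Two q-Pascal steps at once, from row 2n to row 2n + 2. Written in terms of the largest
  indices (\<open>A\<close> and \<open>B\<close>), all four terms are \<open>P * A * B\<close> times
  a polynomial in \<open>q\<close>, \<open>X\<close>, \<open>Y\<close>, and a polynomial identity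
  remains.\<close>

lemma qcentral_rec:
  assumes "norm q < 1" "q \<noteq> 0"
  shows "qcentral q (Suc n) k = (1 + q ^ (2 * n + 1)) * qcentral q n k
           + q powi (int n + 1 - k) * qcentral q n (k - 1)
           + q powi (int n + 1 + k) * qcentral q n (k + 1)"
proof -
  define A where "A = rqfact q (int n + 1 + k)"
  define B where "B = rqfact q (int n + 1 - k)"
  define X where "X = q powi (int n + k)"
  define Y where "Y = q powi (int n - k)"
  define P where "P = (\<Prod>j<2*n. 1 - q ^ j * q)"
  have XY: "X * Y = q ^ (2 * n)"
    unfolding X_def Y_def using assms
    by (simp flip: power_int_add power_int_of_nat)
  have X': "q powi (int n + k + 1) = q * X" "q powi (int n - k + 1) = q * Y"
    unfolding X_def Y_def using assms by (simp_all add: power_int_add)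
  have a1: "rqfact q (int n + k) = (1 - q * X) * A"
    using rqfact_rec[OF assms, of "int n + k + 1"] X' by (simp add: A_def add_ac)
  have b1: "rqfact q (int n - k) = (1 - q * Y) * B"
    using rqfact_rec[OF assms, of "int n - k + 1"] X' by (simp add: B_def algebra_simps)
  have a2: "rqfact q (int n + k - 1) = (1 - X) * (1 - q * X) * A"
    using rqfact_rec[OF assms, of "int n + k"] a1 by (simp add: X_def)
  have b2: "rqfact q (int n - k - 1) = (1 - Y) * (1 - q * Y) * B"
    using rqfact_rec[OF assms, of "int n - k"] b1 by (simp add: Y_def)
  have e0: "qcentral q (Suc n) k = P * (1 - q * (X * Y)) * (1 - q * q * (X * Y)) * A * B"
    unfolding qcentral_def XY A_def B_def P_def by (simp add: algebra_simps)
  have e1: "qcentral q n k = P * ((1 - q * X) * A) * ((1 - q * Y) * B)"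
    unfolding qcentral_def a1 b1 P_def ..
  have e2: "qcentral q n (k - 1) = P * ((1 - X) * (1 - q * X) * A) * B"
    unfolding qcentral_def P_def a2[symmetric] B_def by (simp add: add_diff_eq diff_diff_eq2)
  have e3: "qcentral q n (k + 1) = P * A * ((1 - Y) * (1 - q * Y) * B)"
    unfolding qcentral_def P_def b2[symmetric] A_def by (simp add: diff_diff_eq add_ac)
  have p: "q ^ (2 * n + 1) = q * (X * Y)"
    by (simp add: XY)
  have pw: "q powi (int n + 1 - k) = q * Y" "q powi (int n + 1 + k) = q * X"
    using X' by (simp_all add: algebra_simps)
  show ?thesis
    unfolding e0 e1 e2 e3 p pw by (simp add: algebra_simps)
qed

text \<open>The finite triple product. Summing over all integers, although only finitely many terms
  are nonzero, makes the shifts of \<open>k\<close> bijections of the index set, with no boundary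
  terms.\<close>

lemma qcentral_has_sum:
  assumes "norm p < 1" "p \<noteq> 0" "w \<noteq> 0"
  shows "((\<lambda>k. qcentral (p\<^sup>2) n k * p powi (k\<^sup>2) * w powi k) has_sum
           (\<Prod>j<n. (1 + p ^ (2 * j + 1) * w) * (1 + p ^ (2 * j + 1) / w))) UNIV"
proof (induction n)
  case 0
  \<comment> \<open>For \<open>k\<close> nonzero, one of \<open>k\<close> and \<open>- k\<close> is
    negative and its \<open>rqfact\<close> is 0.\<close>
  have "qcentral (p\<^sup>2) 0 k = (if k = 0 then 1 else 0)" for k
    by (auto simp: qcentral_def rqfact_def)
  then have "((\<lambda>k. qcentral (p\<^sup>2) 0 k * p powi (k\<^sup>2) * w powi k) has_sum 1) {0}"
    by (auto intro: has_sum_finiteI)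
  moreover have "((\<lambda>k. qcentral (p\<^sup>2) 0 k * p powi (k\<^sup>2) * w powi k) has_sum 1) {0} \<longleftrightarrow>
      ((\<lambda>k. qcentral (p\<^sup>2) 0 k * p powi (k\<^sup>2) * w powi k) has_sum 1) UNIV"
    by (rule has_sum_cong_neutral) (auto simp: qcentral_def rqfact_def)
  ultimately show ?case by simp
next
  case (Suc n)
  define f where "f = (\<lambda>k. qcentral (p\<^sup>2) n k * p powi (k\<^sup>2) * w powi k)"
  define S where "S = (\<Prod>j<n. (1 + p ^ (2 * j + 1) * w) * (1 + p ^ (2 * j + 1) / w))"
  define t where "t = p ^ (2 * n + 1)"
  have q: "norm (p\<^sup>2) < 1" "p\<^sup>2 \<noteq> 0"
    using assms by (auto simp: norm_power power_less_one_iff abs_square_less_1)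
  have f: "(f has_sum S) UNIV"
    using Suc.IH unfolding f_def S_def .
  have fm: "((\<lambda>k. f (k - 1)) has_sum S) UNIV"
    by (rule iffD2[OF has_sum_reindex_bij_betw f])
       (rule bij_betwI[where g = "\<lambda>k. k + 1"], auto)
  have fp: "((\<lambda>k. f (k + 1)) has_sum S) UNIV"
    by (rule iffD2[OF has_sum_reindex_bij_betw f])
       (rule bij_betwI[where g = "\<lambda>k. k - 1"], auto)
  \<comment> \<open>The new factor is
    \<open>(1 + t * w) * (1 + t / w) = 1 + t^2 + t * w + t / w\<close>. Its three kinds of terms
    match those of \<open>qcentral_rec\<close> after completing the square: 2(n + 1 - k) + k^2 = (2n
    + 1) + (k - 1)^2, and similarly for k + 1.\<close>
  have "((\<lambda>k. (1 + t\<^sup>2) * f k + t * w * f (k - 1) + t / w * f (k + 1)) has_sum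
           ((1 + t\<^sup>2) * S + t * w * S + t / w * S)) UNIV"
    by (intro has_sum_add has_sum_cmult_right f fm fp)
  also have "(1 + t\<^sup>2) * S + t * w * S + t / w * S = S * ((1 + t * w) * (1 + t / w))"
    using assms by (simp add: field_simps power2_eq_square)
  also have "(\<lambda>k. (1 + t\<^sup>2) * f k + t * w * f (k - 1) + t / w * f (k + 1)) =
      (\<lambda>k. qcentral (p\<^sup>2) (Suc n) k * p powi (k\<^sup>2) * w powi k)"
  proof
    fix k :: int
    have t: "t = p powi (2 * int n + 1)"
      unfolding t_def power_int_of_nat[symmetric] by (simp add: add.commute)
    have pq: "(p\<^sup>2) powi m = p powi (2 * m)" for m
      by (simp add: power_int_mult)
    have c0: "(p\<^sup>2) ^ (2 * n + 1) = t\<^sup>2"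
      unfolding t_def power_mult[symmetric] by (simp add: mult.commute)
    have c1: "(p\<^sup>2) powi (int n + 1 - k) * p powi (k\<^sup>2) * w powi k = t * w * (p powi ((k - 1)\<^sup>2) * w powi (k - 1))"
    proof -
      have "(p\<^sup>2) powi (int n + 1 - k) * p powi (k\<^sup>2) = t * p powi ((k - 1)\<^sup>2)"
        unfolding pq t using assms by (simp flip: power_int_add) (simp add: power2_eq_square algebra_simps)
      moreover have "w powi k = w * w powi (k - 1)"
        using assms by (simp add: power_int_diff)
      ultimately show ?thesis by simp
    qed
    have c2: "(p\<^sup>2) powi (int n + 1 + k) * p powi (k\<^sup>2) * w powi k = t / w * (p powi ((k + 1)\<^sup>2) * w powi (k + 1))"
    proof -
      have "(p\<^sup>2) powi (int n + 1 + k) * p powi (k\<^sup>2) = t * p powi ((k + 1)\<^sup>2)"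
        unfolding pq t using assms by (simp flip: power_int_add) (simp add: power2_eq_square algebra_simps)
      moreover have "w powi k = w powi (k + 1) / w"
        using assms by (simp add: power_int_add)
      ultimately show ?thesis by simp
    qed
    have "qcentral (p\<^sup>2) (Suc n) k * p powi (k\<^sup>2) * w powi k =
      (1 + t\<^sup>2) * f k
      + qcentral (p\<^sup>2) n (k - 1) * ((p\<^sup>2) powi (int n + 1 - k) * p powi (k\<^sup>2) * w powi k)
      + qcentral (p\<^sup>2) n (k + 1) * ((p\<^sup>2) powi (int n + 1 + k) * p powi (k\<^sup>2) * w powi k)"
      unfolding qcentral_rec[OF q] c0 f_def by (simp add: algebra_simps)
    then show "(1 + t\<^sup>2) * f k + t * w * f (k - 1) + t / w * f (k + 1) =
        qcentral (p\<^sup>2) (Suc n) k * p powi (k\<^sup>2) * w powi k"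
      unfolding c1 c2 f_def by (simp add: algebra_simps)
  qed
  finally show ?case
    unfolding S_def t_def by simp
qed

section \<open>Passage to the limit in the finite triple product\<close>

text \<open>Root test: the n-th root of the n-th term is \<open>norm p ^ n * norm v\<close>, which
  tends to 0. Negative indices reduce to positive ones by replacing \<open>w\<close> with its
  inverse.\<close>

lemma abs_summable_theta:
  fixes p w :: complex
  assumes "norm p < 1" "p \<noteq> 0" "w \<noteq> 0"
  shows "(\<lambda>k::int. norm (p powi (k\<^sup>2) * w powi k)) summable_on UNIV"
proof -
  let ?f = "\<lambda>k::int. norm (p powi (k\<^sup>2) * w powi k)"
  have half: "(\<lambda>n. norm (p ^ (n\<^sup>2) * v ^ n)) summable_on UNIV" if "v \<noteq> 0" for v :: complex
  proof -
    have "(\<lambda>n. norm p ^ n * norm v) \<longlonglongrightarrow> 0 * norm v"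
      using assms by (intro tendsto_intros LIMSEQ_realpow_zero) auto
    then have "eventually (\<lambda>n. norm p ^ n * norm v < 1/2) sequentially"
      by (rule order_tendstoD) auto
    then have "eventually (\<lambda>n. norm (norm (p ^ (n\<^sup>2) * v ^ n)) \<le> (1/2) ^ n) sequentially"
    proof eventually_elim
      case (elim n)
      have "norm (p ^ (n\<^sup>2) * v ^ n) = (norm p ^ n * norm v) ^ n"
        by (simp add: norm_mult norm_power power_mult_distrib power2_eq_square power_mult)
      then show ?case
        using elim by (simp add: power_mono)
    qed
    then have "summable (\<lambda>n. norm (p ^ (n\<^sup>2) * v ^ n))"
      by (rule summable_comparison_test_ev) (simp add: summable_geometric)
    then show ?thesis
      by (intro norm_summable_imp_summable_on) simp
  qed
  have "?f summable_on (range int)"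
    using half[OF assms(3)]
    by (subst summable_on_reindex) (auto simp: o_def power_int_of_nat simp flip: of_nat_power)
  moreover have "?f summable_on (range (\<lambda>n. - int n))"
    using half[of "inverse w"] assms
    by (subst summable_on_reindex)
       (auto simp: o_def power_int_of_nat power_int_minus power_inverse inj_def simp flip: of_nat_power)
  ultimately have "?f summable_on (range int \<union> range (\<lambda>n. - int n))"
    by (rule summable_on_union)
  also have "range int \<union> range (\<lambda>n. - int n) = UNIV"
  proof -
    have "k \<in> range int \<union> range (\<lambda>n. - int n)" for k
      by (cases k rule: int_cases2) auto
    then show ?thesis by blast
  qed
  finally show ?thesis .
qed

lemma rqfact_bounded:
  assumes "norm q < 1"
  obtains B where "\<And>m. norm (rqfact q m) \<le> B"
proof -
  have "Bseq (\<lambda>N. inverse (\<Prod>n<N. 1 - q ^ n * q))"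
    using inverse_qpoch_partial_LIMSEQ[OF assms] convergentI convergent_imp_Bseq by blast
  then obtain B where B: "B > 0" "\<And>N. norm (inverse (\<Prod>n<N. 1 - q ^ n * q)) \<le> B"
    unfolding Bseq_def by blast
  have "norm (rqfact q m) \<le> B" for m
    using B by (auto simp: rqfact_def)
  with that show ?thesis by blast
qed

lemma rqfact_LIMSEQ:
  assumes "norm q < 1" "filterlim f at_top sequentially"
  shows "(\<lambda>n. rqfact q (f n)) \<longlonglongrightarrow> inverse (qpoch q q)"
proof -
  have "filterlim (\<lambda>n. nat (f n)) sequentially sequentially"
    using assms(2) filterlim_compose filterlim_nat_sequentially by blast
  then have "(\<lambda>n. inverse (\<Prod>j<nat (f n). 1 - q ^ j * q)) \<longlonglongrightarrow> inverse (qpoch q q)"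
    by (rule filterlim_compose[OF inverse_qpoch_partial_LIMSEQ[OF assms(1)]])
  moreover have "eventually (\<lambda>n. f n \<ge> 0) sequentially"
    using assms(2) by (simp add: filterlim_at_top)
  then have "eventually (\<lambda>n. inverse (\<Prod>j<nat (f n). 1 - q ^ j * q) = rqfact q (f n)) sequentially"
    by eventually_elim (simp add: rqfact_def)
  ultimately show ?thesis
    by (rule Lim_transform_eventually)
qed

lemma qcentral_LIMSEQ:
  assumes "norm q < 1"
  shows "(\<lambda>n. qcentral q n k) \<longlonglongrightarrow> inverse (qpoch q q)"
proof -
  have "(\<lambda>n. \<Prod>j<2*n. 1 - q ^ j * q) \<longlonglongrightarrow> qpoch q q"
    by (rule filterlim_compose[OF qpoch_LIMSEQ[OF assms]])
       (rule filterlim_subseq, simp add: strict_mono_def)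
  moreover have "filterlim (\<lambda>n. int n + m) at_top sequentially" for m
    unfolding filterlim_at_top eventually_sequentially
  proof
    show "\<exists>N. \<forall>n\<ge>N. Z \<le> int n + m" for Z
      by (intro exI[of _ "nat (Z - m)"]) auto
  qed
  from this[of k] this[of "- k"] have "filterlim (\<lambda>n. int n + k) at_top sequentially"
      "filterlim (\<lambda>n. int n - k) at_top sequentially"
    by simp_all
  ultimately have "(\<lambda>n. qcentral q n k) \<longlonglongrightarrow>
      qpoch q q * inverse (qpoch q q) * inverse (qpoch q q)"
    unfolding qcentral_def by (intro tendsto_mult rqfact_LIMSEQ assms)
  then show ?thesis
    using qpoch_self_nonzero[OF assms] by simp
qed

text \<open>Uniformity in both \<open>n\<close> and \<open>k\<close> supplies the majorant for
  dominated convergence; each of the three factors ranges over a bounded set because the partial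
  products converge to a nonzero limit.\<close>

lemma qcentral_bounded:
  assumes "norm q < 1"
  obtains B where "\<And>n k. norm (qcentral q n k) \<le> B"
proof -
  obtain R where R: "\<And>m. norm (rqfact q m) \<le> R"
    using rqfact_bounded[OF assms] by blast
  have "Bseq (\<lambda>N. \<Prod>n<N. 1 - q ^ n * q)"
    using qpoch_LIMSEQ[OF assms] convergentI convergent_imp_Bseq by blast
  then obtain A where A: "A > 0" "\<And>N. norm (\<Prod>n<N. 1 - q ^ n * q) \<le> A"
    unfolding Bseq_def by blast
  have "norm (qcentral q n k) \<le> A * R * R" for n k
    unfolding qcentral_def norm_mult
    using A R order_trans[OF norm_ge_zero R[of 0]] by (intro mult_mono) auto
  with that show ?thesis by blast
qed

text \<open>Limit of the finite form by dominated convergence, with the sums read as integrals over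
  the counting measure. Every Gaussian binomial tends to
  \<open>inverse (qpoch (p\<^sup>2) (p\<^sup>2))\<close>; clearing this common factor produces the
  first product on the right.\<close>

theorem jacobi_triple_product:
  assumes "norm p < 1" "p \<noteq> 0" "w \<noteq> 0"
  shows "(\<Sum>\<^sub>\<infinity>k::int. p powi (k\<^sup>2) * w powi k) =
           qpoch (p\<^sup>2) (p\<^sup>2) * qpoch (p\<^sup>2) (- p * w) * qpoch (p\<^sup>2) (- p / w)"
proof -
  let ?q = "p\<^sup>2" and ?g = "\<lambda>k::int. p powi (k\<^sup>2) * w powi k"
  let ?f = "\<lambda>n k. qcentral (p\<^sup>2) n k * ?g k"
  have q: "norm ?q < 1"
    using assms by (simp add: norm_power abs_square_less_1)
  obtain B where B: "\<And>n k. norm (qcentral ?q n k) \<le> B"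
    using qcentral_bounded[OF q] by blast
  have g: "integrable (count_space UNIV) ?g"
    using abs_summable_theta[OF assms]
    unfolding abs_summable_equivalent Infinite_Set_Sum.abs_summable_on_def .
  have intg: "integrable (count_space UNIV) (\<lambda>k. B * norm (?g k))"
    using g by (intro integrable_mult_right integrable_norm)
  have bound: "norm (?f n k) \<le> B * norm (?g k)" for n k
    by (simp only: norm_mult) (simp add: mult_right_mono B)
  have lim: "(\<lambda>n. ?f n k) \<longlonglongrightarrow> inverse (qpoch ?q ?q) * ?g k" for k
    by (intro tendsto_mult qcentral_LIMSEQ q tendsto_const)
  have fs: "integrable (count_space UNIV) (?f n)" for n
    by (rule Bochner_Integration.integrable_bound[OF intg]) (use order_trans[OF bound abs_ge_self] in auto)
  have "(\<lambda>n. integral\<^sup>L (count_space UNIV) (?f n)) \<longlonglongrightarrow>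
      integral\<^sup>L (count_space UNIV) (\<lambda>k. inverse (qpoch ?q ?q) * ?g k)"
    by (rule integral_dominated_convergence[OF _ _ intg]) (use bound lim in auto)
  also have "integral\<^sup>L (count_space UNIV) (\<lambda>k. inverse (qpoch ?q ?q) * ?g k) =
      inverse (qpoch ?q ?q) * infsum ?g UNIV"
    using infsetsum_infsum[unfolded Infinite_Set_Sum.abs_summable_on_def, OF g]
    by (simp add: infsetsum_def)
  also have "(\<lambda>n. integral\<^sup>L (count_space UNIV) (?f n)) =
      (\<lambda>n. \<Prod>j<n. (1 + p ^ (2 * j + 1) * w) * (1 + p ^ (2 * j + 1) / w))"
  proof
    fix n
    have "integral\<^sup>L (count_space UNIV) (?f n) = infsum (?f n) UNIV"
      using infsetsum_infsum[unfolded Infinite_Set_Sum.abs_summable_on_def, OF fs]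
      by (simp add: infsetsum_def)
    also have "\<dots> = (\<Prod>j<n. (1 + p ^ (2 * j + 1) * w) * (1 + p ^ (2 * j + 1) / w))"
      using infsumI[OF qcentral_has_sum[OF assms]] by (simp add: mult.assoc)
    finally show "integral\<^sup>L (count_space UNIV) (?f n) = \<dots>" .
  qed
  finally have l1: "(\<lambda>n. \<Prod>j<n. (1 + p ^ (2 * j + 1) * w) * (1 + p ^ (2 * j + 1) / w))
      \<longlonglongrightarrow> inverse (qpoch ?q ?q) * infsum ?g UNIV" .
  have l2: "(\<lambda>n. (\<Prod>j<n. 1 - ?q ^ j * (- p * w)) * (\<Prod>j<n. 1 - ?q ^ j * (- p / w)))
      \<longlonglongrightarrow> qpoch ?q (- p * w) * qpoch ?q (- p / w)"
    by (intro tendsto_mult qpoch_LIMSEQ q)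
  have "(\<Prod>j<n. 1 - ?q ^ j * (- p * w)) * (\<Prod>j<n. 1 - ?q ^ j * (- p / w)) =
      (\<Prod>j<n. (1 + p ^ (2 * j + 1) * w) * (1 + p ^ (2 * j + 1) / w))" for n
    unfolding prod.distrib[symmetric]
    by (rule prod.cong) (auto simp: power_mult[symmetric] mult_ac)
  then have "inverse (qpoch ?q ?q) * infsum ?g UNIV = qpoch ?q (- p * w) * qpoch ?q (- p / w)"
    using LIMSEQ_unique[OF l1] l2 by simp
  then show ?thesis
    using qpoch_self_nonzero[OF q] by (simp add: field_simps)
qed

section \<open>The prime form\<close>

definition nome :: "complex \<Rightarrow> complex" where
  "nome \<tau> = exp (2 * pi * \<i> * \<tau>)"

lemma norm_nome_less_1: "Im \<tau> > 0 \<Longrightarrow> norm (nome \<tau>) < 1"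
  by (simp add: nome_def)

lemma nome_add: "nome (x + y) = nome x * nome y"
  by (simp add: nome_def ring_distribs exp_add)

lemma nome_of_int: "nome (of_int n) = 1"
  using exp_integer_2pi[of "of_int n"] by (simp add: nome_def mult_ac)

lemma nome_eq_1_iff: "nome z = 1 \<longleftrightarrow> z \<in> \<int>"
proof
  assume "nome z = 1"
  then obtain n where "2 * pi * \<i> * z = of_int (2 * n) * pi * \<i>"
    unfolding nome_def exp_eq_1 by (auto simp: complex_eq_iff)
  then have "z = of_int n" by simp
  then show "z \<in> \<int>" by simp
qed (auto elim!: Ints_cases simp: nome_of_int)

lemma nome_power: "nome z ^ n = nome (of_nat n * z)"
  by (simp add: nome_def exp_of_nat_mult[symmetric] mult_ac)

text \<open>This is 2 pi i theta_1(z) / theta_1'(0) as a product. The division by the squared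
  product makes the derivative at 0 equal to 2 pi i for every \<tau>.\<close>

definition prime_form :: "complex \<Rightarrow> complex \<Rightarrow> complex" where
  "prime_form \<tau> z = (exp (pi * \<i> * z) - exp (- (pi * \<i> * z))) *
     qpoch (nome \<tau>) (nome (\<tau> + z)) * qpoch (nome \<tau>) (nome (\<tau> - z)) / qpoch (nome \<tau>) (nome \<tau>) ^ 2"

definition period_lattice :: "complex \<Rightarrow> complex set" where
  "period_lattice \<tau> = {of_int m * \<tau> + of_int n |m n :: int. True}"

lemma half_power: "exp (pi * \<i> * z) ^ 2 = nome z"
proof -
  have "nome z = exp (2 * (pi * \<i> * z))"
    by (simp only: nome_def mult.assoc of_real_mult of_real_numeral)
  then show ?thesis
    by (simp only: exp_double)
qed

text \<open>The sine factor becomes the missing index-0 factor of the first product. This less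
  symmetric form displays the zeros and is the one that the triple product yields.\<close>

lemma prime_form_conv_qpoch:
  assumes "Im \<tau> > 0"
  shows "prime_form \<tau> z = - exp (- (pi * \<i> * z)) * qpoch (nome \<tau>) (nome z) *
           qpoch (nome \<tau>) (nome (\<tau> - z)) / qpoch (nome \<tau>) (nome \<tau>) ^ 2"
proof -
  have "exp (pi * \<i> * z) - exp (- (pi * \<i> * z)) = - exp (- (pi * \<i> * z)) * (1 - nome z)"
    unfolding half_power[symmetric] exp_minus by (simp add: field_simps power2_eq_square)
  moreover have "qpoch (nome \<tau>) (nome z) = (1 - nome z) * qpoch (nome \<tau>) (nome (\<tau> + z))"
    unfolding nome_add by (rule qpoch_rec[OF norm_nome_less_1[OF assms]])
  ultimately show ?thesis
    unfolding prime_form_def by simp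
qed

lemma prime_form_minus: "prime_form \<tau> (- z) = - prime_form \<tau> z"
proof -
  define s where "s = exp (pi * \<i> * z) - exp (- (pi * \<i> * z))"
  have "exp (pi * \<i> * - z) - exp (- (pi * \<i> * - z)) = - s"
    by (simp add: s_def)
  then show ?thesis
    unfolding prime_form_def s_def[symmetric] by simp
qed

lemma prime_form_plus_1: "prime_form \<tau> (z + 1) = - prime_form \<tau> z"
proof -
  have "nome (\<tau> + (z + 1)) = nome (\<tau> + z)" "nome (\<tau> - (z + 1)) = nome (\<tau> - z)"
    using nome_add[of "\<tau> + z" 1] nome_add[of "\<tau> - (z + 1)" 1] nome_of_int[of 1]
    by (simp_all add: add_ac)
  moreover define s where "s = exp (pi * \<i> * z) - exp (- (pi * \<i> * z))"
  have "exp (pi * \<i> * (z + 1)) - exp (- (pi * \<i> * (z + 1))) = - s"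
    by (simp add: s_def ring_distribs exp_add exp_minus exp_diff)
  ultimately show ?thesis
    unfolding prime_form_def s_def[symmetric] by simp
qed

text \<open>The shift by \<tau> moves the two products by one index in opposite directions: one
  loses \<open>1 - nome z\<close>, the other gains \<open>1 - nome (- z)\<close>, and the ratio of
  these is an exponential.\<close>

lemma prime_form_plus_tau:
  assumes "Im \<tau> > 0"
  shows "prime_form \<tau> (z + \<tau>) = - exp (- (pi * \<i> * (\<tau> + 2 * z))) * prime_form \<tau> z"
proof -
  have r: "qpoch (nome \<tau>) (nome (- z)) = (1 - nome (- z)) * qpoch (nome \<tau>) (nome (\<tau> - z))"
    unfolding qpoch_rec[OF norm_nome_less_1[OF assms], of "nome (- z)"]
    by (simp flip: nome_add)
  have e: "exp (- (pi * \<i> * (\<tau> + 2 * z))) * (exp (pi * \<i> * z) - exp (- (pi * \<i> * z)))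
      = exp (- (pi * \<i> * (z + \<tau>))) * (1 - nome (- z))"
    by (simp add: nome_def ring_distribs flip: exp_add) (simp add: mult_ac)
  have "prime_form \<tau> (z + \<tau>) = - (exp (- (pi * \<i> * (z + \<tau>))) * (1 - nome (- z))) *
      qpoch (nome \<tau>) (nome (\<tau> + z)) * qpoch (nome \<tau>) (nome (\<tau> - z)) / qpoch (nome \<tau>) (nome \<tau>) ^ 2"
    unfolding prime_form_conv_qpoch[OF assms] using r by (simp add: add.commute)
  then show ?thesis
    unfolding e[symmetric] prime_form_def by simp
qed

text \<open>Stated for any \<open>f\<close> because it also serves a competitor of the prime form in
  the uniqueness proof. Signs are kept as \<open>exp (pi * \<i> * n)\<close>, so that everything is
  one exponent; removing the integer shift before the multiple of \<tau> avoids a mixed term in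
  \<open>m * n\<close>.\<close>

lemma quasi_periodic_iterate:
  assumes 1: "\<And>z. f (z + 1) = - f z"
    and 2: "\<And>z. f (z + \<tau>) = - exp (- (pi * \<i> * (\<tau> + 2 * z))) * f z"
  shows "f (z + of_int m * \<tau> + of_int n) =
    exp (pi * \<i> * (of_int m + of_int n - of_int m ^ 2 * \<tau> - 2 * of_int m * z)) * f z"
proof -
  have n: "f (z + of_int n) = exp (pi * \<i> * of_int n) * f z" for n z
  proof (induction n rule: int_induct[of _ 0])
    case (step1 i)
    have "f (z + of_int (i + 1)) = f (z + of_int i + 1)"
      by (simp add: add.assoc)
    also have "\<dots> = exp (pi * \<i>) * (exp (pi * \<i> * of_int i) * f z)"
      unfolding 1 step1 by simp
    finally show ?case
      by (simp add: ring_distribs exp_add)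
  next
    case (step2 i)
    have "f (z + of_int (i - 1)) = - f (z + of_int (i - 1) + 1)"
      unfolding 1 by simp
    also have "z + of_int (i - 1) + 1 = z + of_int i"
      by simp
    also have "- f (z + of_int i) = exp (- (pi * \<i>)) * (exp (pi * \<i> * of_int i) * f z)"
      unfolding step2 by (simp add: exp_minus)
    finally show ?case
      by (simp add: ring_distribs exp_diff exp_minus)
  qed auto
  have m: "f (z + of_int m * \<tau>) =
      exp (pi * \<i> * (of_int m - of_int m ^ 2 * \<tau> - 2 * of_int m * z)) * f z" for m z
  proof (induction m rule: int_induct[of _ 0])
    case (step1 i)
    have "f (z + of_int (i + 1) * \<tau>) = exp (pi * \<i>) * exp (- (pi * \<i> * (\<tau> + 2 * (z + of_int i * \<tau>)))) *
        exp (pi * \<i> * (of_int i - of_int i ^ 2 * \<tau> - 2 * of_int i * z)) * f z"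
    proof -
      have "f (z + of_int (i + 1) * \<tau>) = f (z + of_int i * \<tau> + \<tau>)"
        by (simp add: ring_distribs add.assoc)
      then show ?thesis
        unfolding 2 step1 by simp
    qed
    also have "\<dots> = exp (pi * \<i> * (of_int (i + 1) - of_int (i + 1) ^ 2 * \<tau> - 2 * of_int (i + 1) * z)) * f z"
      unfolding exp_add[symmetric] by (simp add: power2_eq_square algebra_simps)
    finally show ?case .
  next
    case (step2 i)
    define w where "w = z + of_int (i - 1) * \<tau>"
    have w: "w + \<tau> = z + of_int i * \<tau>" by (simp add: w_def algebra_simps)
    have "f w = exp (- (pi * \<i>)) * exp (pi * \<i> * (\<tau> + 2 * w)) * f (w + \<tau>)"
      unfolding 2[of w] by (simp add: exp_minus)
    also have "\<dots> = exp (- (pi * \<i>)) * exp (pi * \<i> * (\<tau> + 2 * w)) *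
        exp (pi * \<i> * (of_int i - of_int i ^ 2 * \<tau> - 2 * of_int i * z)) * f z"
      unfolding w step2 by simp
    also have "\<dots> = exp (pi * \<i> * (of_int (i - 1) - of_int (i - 1) ^ 2 * \<tau> - 2 * of_int (i - 1) * z)) * f z"
      unfolding exp_add[symmetric] w_def by (simp add: power2_eq_square algebra_simps)
    finally show ?case unfolding w_def .
  qed auto
  show ?thesis
    unfolding n m mult.assoc[symmetric] exp_add[symmetric] by (simp add: algebra_simps)
qed

lemma prime_form_eq_0_iff:
  assumes "Im \<tau> > 0"
  shows "prime_form \<tau> z = 0 \<longleftrightarrow> z \<in> period_lattice \<tau>"
proof
  note q = norm_nome_less_1[OF assms]
  assume "prime_form \<tau> z = 0"
  then have "qpoch (nome \<tau>) (nome z) = 0 \<or> qpoch (nome \<tau>) (nome (\<tau> - z)) = 0"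
    unfolding prime_form_conv_qpoch[OF assms] using qpoch_self_nonzero[OF q] by simp
  then have "\<exists>n::nat. nome (of_nat n * \<tau> + z) = 1 \<or> nome (of_nat n * \<tau> + (\<tau> - z)) = 1"
    unfolding qpoch_eq_0_iff[OF q] nome_power nome_add[symmetric] by blast
  then obtain n :: nat where "of_nat n * \<tau> + z \<in> \<int> \<or> of_nat n * \<tau> + (\<tau> - z) \<in> \<int>"
    unfolding nome_eq_1_iff by blast
  then show "z \<in> period_lattice \<tau>"
  proof
    assume "of_nat n * \<tau> + z \<in> \<int>"
    then obtain k where "of_nat n * \<tau> + z = of_int k" by (elim Ints_cases)
    then have "z = of_int (- int n) * \<tau> + of_int k" by (simp add: algebra_simps)
    then show ?thesis unfolding period_lattice_def by blast
  next
    assume "of_nat n * \<tau> + (\<tau> - z) \<in> \<int>"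
    then obtain k where "of_nat n * \<tau> + (\<tau> - z) = of_int k" by (elim Ints_cases)
    then have "z = of_int (int n + 1) * \<tau> + of_int (- k)" by (simp add: algebra_simps)
    then show ?thesis unfolding period_lattice_def by blast
  qed
next
  assume "z \<in> period_lattice \<tau>"
  then obtain m n where z: "z = 0 + of_int m * \<tau> + of_int n"
    unfolding period_lattice_def by auto
  have "prime_form \<tau> 0 = 0"
    by (simp add: prime_form_def)
  then show "prime_form \<tau> z = 0"
    unfolding z quasi_periodic_iterate[of "prime_form \<tau>", OF prime_form_plus_1 prime_form_plus_tau[OF assms]]
    by simp
qed

lemma holomorphic_prime_form:
  assumes "Im \<tau> > 0"
  shows "prime_form \<tau> holomorphic_on UNIV"
proof -
  have *: "(\<lambda>z. qpoch (nome \<tau>) (nome (f z))) holomorphic_on UNIV" if "f holomorphic_on UNIV" for f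
  proof -
    have "(\<lambda>z. nome (f z)) holomorphic_on UNIV"
      unfolding nome_def by (intro holomorphic_intros that)
    from holomorphic_on_compose_gen[OF this holomorphic_qpoch[OF norm_nome_less_1[OF assms]]]
    show ?thesis by (simp add: o_def)
  qed
  show ?thesis
    unfolding prime_form_def using qpoch_self_nonzero[OF norm_nome_less_1[OF assms]]
    by (intro holomorphic_intros *) auto
qed

text \<open>Both products tend to \<open>Q\<close> and cancel the denominator, so only the
  derivative of the sine factor is left. This records at once that the zero at 0 is simple and how
  the function is normalised.\<close>

lemma prime_form_over_z_tendsto:
  assumes "Im \<tau> > 0"
  shows "(\<lambda>z. prime_form \<tau> z / z) \<midarrow>0\<rightarrow> 2 * pi * \<i>"
proof -
  define Q where "Q = qpoch (nome \<tau>) (nome \<tau>)"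
  have Q: "Q \<noteq> 0"
    unfolding Q_def by (rule qpoch_self_nonzero[OF norm_nome_less_1[OF assms]])
  have "isCont (qpoch (nome \<tau>)) x" for x
    using holomorphic_on_imp_continuous_on[OF holomorphic_qpoch[OF norm_nome_less_1[OF assms]]]
    by (simp add: continuous_on_eq_continuous_at)
  then have c: "(\<lambda>z. qpoch (nome \<tau>) (nome (f z))) \<midarrow>0\<rightarrow> qpoch (nome \<tau>) (nome (f 0))" if "isCont f 0" for f
  proof -
    have "isCont (\<lambda>z. nome (f z)) 0"
      unfolding nome_def by (intro continuous_intros that)
    from isCont_o2[OF this] show ?thesis
      using \<open>\<And>x. isCont (qpoch (nome \<tau>)) x\<close> by (auto simp: isCont_def)
  qed
  have "((\<lambda>z. exp (pi * \<i> * z) - exp (- (pi * \<i> * z))) has_field_derivative 2 * pi * \<i>) (at 0)"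
    by (auto intro!: derivative_eq_intros)
  then have d: "(\<lambda>z. (exp (pi * \<i> * z) - exp (- (pi * \<i> * z))) / z) \<midarrow>0\<rightarrow> 2 * pi * \<i>"
    by (simp add: has_field_derivative_iff)
  have "(\<lambda>z. (exp (pi * \<i> * z) - exp (- (pi * \<i> * z))) / z *
      qpoch (nome \<tau>) (nome (\<tau> + z)) * qpoch (nome \<tau>) (nome (\<tau> - z)) / Q ^ 2)
      \<midarrow>0\<rightarrow> 2 * pi * \<i> * qpoch (nome \<tau>) (nome (\<tau> + 0)) * qpoch (nome \<tau>) (nome (\<tau> - 0)) / Q ^ 2"
    using Q by (intro tendsto_intros d c continuous_intros) auto
  then show ?thesis
    using Q by (simp add: Q_def prime_form_def power2_eq_square mult_ac)
qed

section \<open>Modular transformation of the prime form\<close>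

lemma doubly_periodic_iterate:
  assumes 1: "\<And>z. h (z + 1) = h z" and 2: "\<And>z. h (z + \<tau>) = h z"
  shows "h (z + of_int m * \<tau> + of_int n) = h (z :: complex)"
proof -
  have n: "h (z + of_int n) = h z" for n z
  proof (induction n rule: int_induct[of _ 0])
    case (step1 i)
    then show ?case
      using 1[of "z + of_int i"] by (simp add: add.assoc)
  next
    case (step2 i)
    then show ?case
      using 1[of "z + of_int (i - 1)"] by (simp add: add.assoc)
  qed auto
  have m: "h (z + of_int m * \<tau>) = h z" for m z
  proof (induction m rule: int_induct[of _ 0])
    case (step1 i)
    then show ?case
      using 2[of "z + of_int i * \<tau>"] by (simp add: ring_distribs add.assoc)
  next
    case (step2 i)
    then show ?case
      using 2[of "z + of_int (i - 1) * \<tau>"] by (simp add: ring_distribs add.assoc)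
  qed auto
  show ?thesis
    by (simp only: n m)
qed

lemma doubly_periodic_entire_constant:
  assumes "Im \<tau> > 0" "h holomorphic_on UNIV"
    and 1: "\<And>z. h (z + 1) = h z" and 2: "\<And>z. h (z + \<tau>) = h z"
  shows "h z = h 0"
proof -
  have cont: "continuous_on UNIV h"
    using assms(2) by (rule holomorphic_on_imp_continuous_on)
  let ?P = "(\<lambda>(s, t). of_real s * \<tau> + of_real t) ` ({0..1} \<times> {0..1} :: (real \<times> real) set)"
  have "compact ?P"
    by (intro compact_continuous_image compact_Times compact_Icc)
       (auto simp: case_prod_unfold intro!: continuous_intros)
  then have "compact (h ` ?P)"
    by (rule compact_continuous_image[OF continuous_on_subset[OF cont subset_UNIV]])
  then have "bounded (h ` ?P)"
    by (rule compact_imp_bounded)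
  then obtain B where B: "\<And>z. z \<in> ?P \<Longrightarrow> norm (h z) \<le> B"
    unfolding bounded_iff by blast
  have bound: "norm (h z) \<le> B" for z
  proof -
    define s where "s = Im z / Im \<tau>"
    define t where "t = Re z - s * Re \<tau>"
    have z: "z = of_real s * \<tau> + of_real t"
      using assms(1) by (simp add: complex_eq_iff s_def t_def)
    define w where "w = of_real (frac s) * \<tau> + of_real (frac t)"
    have "w \<in> ?P"
      unfolding w_def image_iff using frac_ge_0[of s] frac_lt_1[of s] frac_ge_0[of t] frac_lt_1[of t]
      by (intro bexI[of _ "(frac s, frac t)"]) auto
    moreover have "z = w + of_int \<lfloor>s\<rfloor> * \<tau> + of_int \<lfloor>t\<rfloor>"
      unfolding z w_def frac_def by (simp add: ring_distribs)
    then have "h z = h w"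
      by (simp only: doubly_periodic_iterate[of h, OF 1 2])
    ultimately show ?thesis
      using B by simp
  qed
  \<comment> \<open>Boundedness is polynomial growth of degree 0, so the Taylor polynomial has only
    its constant term.\<close>
  have "h z = (\<Sum>k\<le>0. (deriv ^^ k) h 0 / fact k * z ^ k)"
    by (rule Liouville_polynomial[OF assms(2), of 0 B]) (use bound in auto)
  then show ?thesis by simp
qed

lemma period_lattice_0: "0 \<in> period_lattice \<tau>"
  unfolding period_lattice_def by (auto intro!: exI[of _ 0])

lemma period_lattice_plus:
  "z + (of_int m * \<tau> + of_int n) \<in> period_lattice \<tau> \<longleftrightarrow> z \<in> period_lattice \<tau>"
proof -
  have *: "z + (of_int m * \<tau> + of_int n) \<in> period_lattice \<tau>" if z: "z \<in> period_lattice \<tau>" for z m n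
  proof -
    obtain m' n' where "z = of_int m' * \<tau> + of_int n'"
      using z unfolding period_lattice_def by blast
    then have "z + (of_int m * \<tau> + of_int n) = of_int (m' + m) * \<tau> + of_int (n' + n)"
      by (simp add: algebra_simps)
    then show ?thesis unfolding period_lattice_def by blast
  qed
  from *[of "z + (of_int m * \<tau> + of_int n)" "- m" "- n"] * show ?thesis
    by (auto simp: algebra_simps)
qed

text \<open>The quotient of the two functions is doubly periodic, and its only possible poles, at the
  lattice points, are removable because of the common leading term at \<open>0\<close>.\<close>

lemma prime_form_unique:
  assumes \<tau>: "Im \<tau> > 0" and f: "f holomorphic_on UNIV"
    and 1: "\<And>z. f (z + 1) = - f z"
    and 2: "\<And>z. f (z + \<tau>) = - exp (- (pi * \<i> * (\<tau> + 2 * z))) * f z"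
    and lim: "(\<lambda>z. f z / z) \<midarrow>0\<rightarrow> 2 * pi * \<i>"
  shows "f z = prime_form \<tau> z"
proof -
  define g where "g = prime_form \<tau>"
  \<comment> \<open>The value 1 on the lattice is the limit of \<open>f z / g z\<close> at 0, as
    both \<open>f z / z\<close> and \<open>g z / z\<close> tend to the same nonzero number.\<close>
  define h where "h = (\<lambda>z. if z \<in> period_lattice \<tau> then 1 else f z / g z)"
  have g: "g holomorphic_on UNIV"
    unfolding g_def by (rule holomorphic_prime_form[OF \<tau>])
  have g0: "g z = 0 \<longleftrightarrow> z \<in> period_lattice \<tau>" for z
    unfolding g_def by (rule prime_form_eq_0_iff[OF \<tau>])
  have glim: "(\<lambda>z. g z / z) \<midarrow>0\<rightarrow> 2 * pi * \<i>"
    unfolding g_def by (rule prime_form_over_z_tendsto[OF \<tau>])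
  have h1: "h (z + 1) = h z" for z
    using period_lattice_plus[of z 0 \<tau> 1] prime_form_plus_1[of \<tau> z] 1[of z]
    by (simp add: h_def g_def)
  have h2: "h (z + \<tau>) = h z" for z
    using period_lattice_plus[of z 1 \<tau> 0] prime_form_plus_tau[OF \<tau>, of z] 2[of z]
    by (simp add: h_def g_def)
  have opn: "open (- period_lattice \<tau>)"
  proof -
    have "open (g -` (- {0}))"
      using holomorphic_on_imp_continuous_on[OF g] by (intro open_vimage) auto
    also have "g -` (- {0}) = - period_lattice \<tau>"
      using g0 by auto
    finally show ?thesis .
  qed
  have h_off: "h holomorphic_on - period_lattice \<tau>"
  proof (rule holomorphic_transform)
    show "(\<lambda>z. f z / g z) holomorphic_on - period_lattice \<tau>"
      using f g g0 by (intro holomorphic_intros) (auto intro: holomorphic_on_subset)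
  qed (auto simp: h_def)
  obtain r where r: "r > 0" and hr: "h holomorphic_on ball 0 r"
  proof -
    \<comment> \<open>This isolates the lattice point 0: lattice points are zeros of
      \<open>g\<close>, and \<open>g z / z\<close> has no zero nearby.\<close>
    have "eventually (\<lambda>z. g z / z \<noteq> 0) (at 0)"
      by (rule tendsto_imp_eventually_ne[OF glim]) simp
    then obtain r where r: "r > 0" "\<And>z. z \<noteq> 0 \<Longrightarrow> dist z 0 < r \<Longrightarrow> g z / z \<noteq> 0"
      unfolding eventually_at by blast
    have nl: "z \<in> period_lattice \<tau> \<longleftrightarrow> z = 0" if "z \<in> ball 0 r" for z
      using r(2)[of z] that period_lattice_0 g0[of z] by (auto simp: dist_commute)
    have "(\<lambda>z. (f z / z) / (g z / z)) \<midarrow>0\<rightarrow> (2 * pi * \<i>) / (2 * pi * \<i>)"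
      by (intro tendsto_divide lim glim) simp
    then have "(\<lambda>z. (f z / z) / (g z / z)) \<midarrow>0\<rightarrow> 1"
      by simp
    moreover have "eventually (\<lambda>z. (f z / z) / (g z / z) = f z / g z) (at 0)"
      by (auto simp: eventually_at intro!: exI[of _ 1])
    ultimately have L: "(\<lambda>z. f z / g z) \<midarrow>0\<rightarrow> 1"
      by (rule Lim_transform_eventually)
    have "(\<lambda>z. if z = 0 then 1 else f z / g z) holomorphic_on ball 0 r"
    proof (rule removable_singularity[OF _ _ L])
      show "(\<lambda>z. f z / g z) holomorphic_on ball 0 r - {0}"
        using f g g0 nl by (intro holomorphic_intros) (auto intro: holomorphic_on_subset)
    qed auto
    then have "h holomorphic_on ball 0 r"
      by (rule holomorphic_transform) (auto simp: h_def nl)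
    with r(1) that show ?thesis by blast
  qed
  have "h field_differentiable (at z)" for z
  proof (cases "z \<in> period_lattice \<tau>")
    case False
    then show ?thesis
      using h_off opn holomorphic_on_imp_differentiable_at by blast
  next
    case True
    then obtain m n where z: "z = of_int m * \<tau> + of_int n"
      unfolding period_lattice_def by blast
    \<comment> \<open>Periodicity carries differentiability from 0 to every other lattice
      point.\<close>
    have "h w = h (w - z)" for w
      using doubly_periodic_iterate[of h \<tau> "w - z" m n, OF h1 h2] by (simp add: z)
    then have eq: "h = (\<lambda>w. h (w - z))" by blast
    have "h field_differentiable (at (z - z))"
      using hr r holomorphic_on_imp_differentiable_at[of h "ball 0 r" 0] by simp
    then have "(h \<circ> (\<lambda>w. w - z)) field_differentiable (at z)"
      by (intro field_differentiable_compose) (auto intro!: derivative_intros)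
    then show ?thesis
      by (subst eq) (simp add: o_def)
  qed
  then have "h holomorphic_on UNIV"
    by (simp add: holomorphic_on_def)
  from doubly_periodic_entire_constant[OF \<tau> this h1 h2] have hz: "h z = h 0" for z .
  show ?thesis
  proof (cases "z \<in> period_lattice \<tau>")
    case False
    then have "f z / g z = 1"
      using hz[of z] period_lattice_0 by (simp add: h_def)
    then show ?thesis
      using False g0[of z] by (simp add: g_def)
  next
    case True
    then obtain m n where z: "z = 0 + of_int m * \<tau> + of_int n"
      unfolding period_lattice_def by auto
    \<comment> \<open>On the lattice \<open>h\<close> is 1 by definition and says nothing about
      \<open>f\<close>. The zero of \<open>f\<close> at 0 comes from the limit of
      \<open>f z / z\<close>, and quasi-periodicity spreads it over the lattice.\<close>
    have "isCont f 0"
      using holomorphic_on_imp_continuous_on[OF f] by (simp add: continuous_on_eq_continuous_at)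
    then have "f \<midarrow>0\<rightarrow> f 0"
      by (simp add: isCont_def)
    moreover have "(\<lambda>z. f z / z * z) \<midarrow>0\<rightarrow> 2 * pi * \<i> * 0"
      by (intro tendsto_intros lim)
    moreover have "eventually (\<lambda>z. f z / z * z = f z) (at 0)"
      by (auto simp: eventually_at intro!: exI[of _ 1])
    ultimately have "f 0 = 0"
      by (metis LIM_unique Lim_transform_eventually mult_zero_right)
    then have "f z = 0"
      unfolding z quasi_periodic_iterate[of f, OF 1 2] by simp
    moreover have "g z = 0"
      using True g0 by simp
    ultimately show ?thesis
      by (simp add: g_def)
  qed
qed

lemma mobius_denominator_nonzero:
  assumes "a * d - b * c = (1 :: int)" "Im \<tau> > 0"
  shows "of_int c * \<tau> + of_int d \<noteq> 0"
proof
  assume *: "of_int c * \<tau> + of_int d = 0"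
  have "of_int c * Im \<tau> = Im (of_int c * \<tau> + of_int d)"
    by simp
  also have "\<dots> = 0"
    unfolding * by simp
  finally have "of_int c * Im \<tau> = 0" .
  then have "c = 0" using assms(2) by simp
  with * have "d = 0" by simp
  with \<open>c = 0\<close> assms(1) show False by simp
qed

lemma Im_mobius_pos:
  assumes "a * d - b * c = (1 :: int)" "Im \<tau> > 0"
  shows "Im ((of_int a * \<tau> + of_int b) / (of_int c * \<tau> + of_int d)) > 0"
proof -
  define j where "j = of_int c * \<tau> + of_int d"
  have j: "j \<noteq> 0"
    unfolding j_def by (rule mobius_denominator_nonzero[OF assms])
  have "Im ((of_int a * \<tau> + of_int b) / j) = Im ((of_int a * \<tau> + of_int b) * cnj j) / (norm j)\<^sup>2"
    by (simp add: complex_div_cnj[of _ j] flip: of_real_power)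
  also have "Im ((of_int a * \<tau> + of_int b) * cnj j) = of_int (a * d - b * c) * Im \<tau>"
    by (simp add: j_def algebra_simps)
  finally show ?thesis
    using assms j by (simp add: j_def)
qed

lemma exp_pi_i_odd: "odd n \<Longrightarrow> exp (pi * \<i> * of_int n) = -1"
  by (elim oddE) (simp add: ring_distribs exp_add mult_ac exp_integer_2pi[of "of_int _", simplified])

text \<open>Division by \<open>j\<close> maps the lattice of \<tau> onto that of the image point.
  Solving the identity for \<open>prime_form \<tau> z\<close> gives a function \<open>f\<close> to
  which \<open>prime_form_unique\<close> applies: the Gaussian factor absorbs the quadratic
  exponents created by multi-period shifts, and the factor \<open>j\<close> restores the derivative
  at 0.\<close>

theorem prime_form_modular:
  fixes a b c d :: int
  assumes det: "a * d - b * c = 1" and \<tau>: "Im \<tau> > 0"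
  defines "j \<equiv> of_int c * \<tau> + of_int d"
  shows "prime_form ((of_int a * \<tau> + of_int b) / j) (z / j) =
           exp (pi * \<i> * of_int c * z ^ 2 / j) / j * prime_form \<tau> z"
proof -
  define \<tau>' where "\<tau>' = (of_int a * \<tau> + of_int b) / j"
  have j: "j \<noteq> 0"
    unfolding j_def by (rule mobius_denominator_nonzero[OF det \<tau>])
  have \<tau>': "Im \<tau>' > 0"
    unfolding \<tau>'_def j_def by (rule Im_mobius_pos[OF det \<tau>])
  have \<tau>'j: "\<tau>' * j = of_int a * \<tau> + of_int b"
    using j by (simp add: \<tau>'_def)
  \<comment> \<open>The inverse matrix writes \<open>1 / j\<close> and \<open>\<tau> / j\<close> as
    integral combinations of \<open>\<tau>'\<close> and 1, so the two basic shifts of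
    \<open>z\<close> become lattice shifts of \<open>z / j\<close>.\<close>
  have cdet: "of_int a * of_int d - of_int b * of_int c = (1 :: complex)"
    using det by (simp flip: of_int_mult of_int_diff)
  have inv1: "1 / j = of_int a - of_int c * \<tau>'"
  proof -
    have "(of_int a - of_int c * \<tau>') * j = 1"
    proof -
      have "(of_int a - of_int c * \<tau>') * j = of_int a * j - of_int c * (\<tau>' * j)"
        by (simp add: algebra_simps)
      also have "\<dots> = of_int a * of_int d - of_int b * of_int c"
        unfolding \<tau>'j unfolding j_def by (simp add: algebra_simps)
      finally show ?thesis using cdet by simp
    qed
    then show ?thesis using j by (simp add: field_simps)
  qed
  have inv2: "\<tau> / j = of_int d * \<tau>' - of_int b"
  proof -
    have "(of_int d * \<tau>' - of_int b) * j = \<tau>"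
    proof -
      have "(of_int d * \<tau>' - of_int b) * j = of_int d * (\<tau>' * j) - of_int b * j"
        by (simp add: algebra_simps)
      also have "\<dots> = (of_int a * of_int d - of_int b * of_int c) * \<tau>"
        unfolding \<tau>'j unfolding j_def by (simp add: algebra_simps)
      finally show ?thesis using cdet by simp
    qed
    then show ?thesis using j by (simp add: field_simps)
  qed
  note iter = quasi_periodic_iterate[of "prime_form \<tau>'", OF prime_form_plus_1 prime_form_plus_tau[OF \<tau>']]
  define f where "f = (\<lambda>z. j * exp (- (pi * \<i> * of_int c * z ^ 2 / j)) * prime_form \<tau>' (z / j))"
  have "f z = prime_form \<tau> z"
  proof (rule prime_form_unique[OF \<tau>])
    have "(\<lambda>z. z / j) holomorphic_on UNIV"
      using j by (intro holomorphic_intros) auto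
    then have "(\<lambda>z. prime_form \<tau>' (z / j)) holomorphic_on UNIV"
      using holomorphic_on_compose_gen[OF _ holomorphic_prime_form[OF \<tau>']] by (auto simp: o_def)
    then show "f holomorphic_on UNIV"
      unfolding f_def using j by (intro holomorphic_intros) auto
  next
    fix z
    \<comment> \<open>Modulo 2 the number is \<open>(a + 1) * (c + 1) - 1\<close>, and the
      determinant forbids \<open>a\<close> and \<open>c\<close> to be both even. The same argument
      applies to \<open>b\<close> and \<open>d\<close> for the shift by \<tau>.\<close>
    have "odd (a - c - a * c)"
      using det by (metis even_add even_diff even_mult_iff odd_one)
    then have s: "exp (pi * \<i> * of_int (a - c - a * c)) = -1"
      by (rule exp_pi_i_odd)
    have shift: "(z + 1) / j = z / j + of_int (- c) * \<tau>' + of_int a"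
      using inv1 by (simp add: add_divide_distrib)
    have "f (z + 1) = exp (- (pi * \<i> * of_int c * (z + 1) ^ 2 / j)
        + pi * \<i> * (of_int (- c) + of_int a - of_int (- c) ^ 2 * \<tau>' - 2 * of_int (- c) * (z / j)))
        * (j * prime_form \<tau>' (z / j))"
      unfolding f_def shift iter by (simp only: exp_add mult_ac)
    also have "- (pi * \<i> * of_int c * (z + 1) ^ 2 / j)
        + pi * \<i> * (of_int (- c) + of_int a - of_int (- c) ^ 2 * \<tau>' - 2 * of_int (- c) * (z / j))
      = pi * \<i> * of_int (a - c - a * c) + - (pi * \<i> * of_int c * z ^ 2 / j)"
    proof -
      have e: "of_int c * (z + 1) ^ 2 / j = of_int c * z ^ 2 / j + 2 * of_int c * (z / j)
          + of_int c * (of_int a - of_int c * \<tau>')"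
        unfolding inv1[symmetric] by (simp add: add_divide_distrib algebra_simps power2_eq_square)
      have "- (of_int c * (z + 1) ^ 2 / j)
        + (of_int (- c) + of_int a - of_int (- c) ^ 2 * \<tau>' - 2 * of_int (- c) * (z / j))
        = of_int (a - c - a * c) - of_int c * z ^ 2 / j"
        unfolding e by (simp add: algebra_simps power2_eq_square)
      from arg_cong[OF this, of "\<lambda>x. pi * \<i> * x"] show ?thesis
        by (simp add: algebra_simps)
    qed
    finally show "f (z + 1) = - f z"
      unfolding exp_add s by (simp add: f_def)
  next
    fix z
    have "odd (d - b - b * d)"
      using det by (metis even_add even_diff even_mult_iff odd_one)
    then have s: "exp (pi * \<i> * of_int (d - b - b * d)) = -1"
      by (rule exp_pi_i_odd)
    have shift: "(z + \<tau>) / j = z / j + of_int d * \<tau>' + of_int (- b)"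
      using inv2 by (simp add: add_divide_distrib)
    have "f (z + \<tau>) = exp (- (pi * \<i> * of_int c * (z + \<tau>) ^ 2 / j)
        + pi * \<i> * (of_int d + of_int (- b) - of_int d ^ 2 * \<tau>' - 2 * of_int d * (z / j)))
        * (j * prime_form \<tau>' (z / j))"
      unfolding f_def shift iter by (simp only: exp_add mult_ac)
    also have "- (pi * \<i> * of_int c * (z + \<tau>) ^ 2 / j)
        + pi * \<i> * (of_int d + of_int (- b) - of_int d ^ 2 * \<tau>' - 2 * of_int d * (z / j))
      = pi * \<i> * of_int (d - b - b * d) + - (pi * \<i> * (\<tau> + 2 * z)) + - (pi * \<i> * of_int c * z ^ 2 / j)"
    proof -
      have e1: "of_int c * (z + \<tau>) ^ 2 / j = of_int c * z ^ 2 / j + 2 * of_int c * \<tau> * (z / j)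
          + of_int c * \<tau> * (of_int d * \<tau>' - of_int b)"
        unfolding inv2[symmetric] by (simp add: add_divide_distrib algebra_simps power2_eq_square)
      have e2: "of_int c * \<tau> * (z / j) + of_int d * (z / j) = z"
        unfolding distrib_right[symmetric] j_def[symmetric] using j by simp
      have e3: "of_int c * \<tau> * \<tau>' + of_int d * \<tau>' = of_int a * \<tau> + of_int b"
        using \<tau>'j by (simp add: j_def algebra_simps)
      \<comment> \<open>The terms are grouped so that \<open>e2\<close> and \<open>e3\<close>
        eliminate \<open>j\<close> and \<open>\<tau>'\<close>; the coefficient of \<tau> that
        survives is the determinant.\<close>
      have "- (of_int c * (z + \<tau>) ^ 2 / j)
        + (of_int d + of_int (- b) - of_int d ^ 2 * \<tau>' - 2 * of_int d * (z / j))
        = of_int (d - b) + of_int b * of_int c * \<tau> - of_int c * z ^ 2 / j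
          - 2 * (of_int c * \<tau> * (z / j) + of_int d * (z / j))
          - of_int d * (of_int c * \<tau> * \<tau>' + of_int d * \<tau>')"
        unfolding e1 by (simp add: algebra_simps power2_eq_square)
      also have "\<dots> = of_int (d - b - b * d) - ((of_int a * of_int d - of_int b * of_int c) * \<tau> + 2 * z)
          - of_int c * z ^ 2 / j"
        unfolding e2 e3 by (simp add: algebra_simps)
      finally have "- (of_int c * (z + \<tau>) ^ 2 / j)
        + (of_int d + of_int (- b) - of_int d ^ 2 * \<tau>' - 2 * of_int d * (z / j))
        = of_int (d - b - b * d) - (\<tau> + 2 * z) - of_int c * z ^ 2 / j"
        unfolding cdet by simp
      from arg_cong[OF this, of "\<lambda>x. pi * \<i> * x"] show ?thesis
        by (simp add: algebra_simps)
    qed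
    finally show "f (z + \<tau>) = - exp (- (pi * \<i> * (\<tau> + 2 * z))) * f z"
      unfolding exp_add s by (simp add: f_def)
  next
    have "filterlim (\<lambda>z. z / j) (at 0) (at 0)"
      using j by (auto simp: filterlim_at eventually_at intro!: tendsto_eq_intros exI[of _ 1])
    then have "(\<lambda>z. prime_form \<tau>' (z / j) / (z / j)) \<midarrow>0\<rightarrow> 2 * pi * \<i>"
      by (rule filterlim_compose[OF prime_form_over_z_tendsto[OF \<tau>']])
    then have "(\<lambda>z. exp (- (pi * \<i> * of_int c * z ^ 2 / j)) * (prime_form \<tau>' (z / j) / (z / j)))
        \<midarrow>0\<rightarrow> exp (- (pi * \<i> * of_int c * 0 ^ 2 / j)) * (2 * pi * \<i>)"
      using j by (intro tendsto_intros) auto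
    then show "(\<lambda>z. f z / z) \<midarrow>0\<rightarrow> 2 * pi * \<i>"
      using j by (simp add: f_def mult_ac)
  qed
  then show ?thesis
    unfolding \<tau>'_def[symmetric] using j by (simp add: f_def exp_minus field_simps)
qed

section \<open>Klein forms\<close>

text \<open>For real \<open>r\<close> and \<open>s\<close> this is 2 pi i times the classical
  exp(-eta(z) z / 2) sigma(z) at z = r \<tau> + s, with eta the quasi-period map of the Weierstrass
  zeta function. The exponential is exactly what cancels the Gaussian factor of
  \<open>prime_form_modular\<close>.\<close>

definition klein_form :: "complex \<Rightarrow> complex \<Rightarrow> complex \<Rightarrow> complex" where
  "klein_form r s \<tau> = exp (pi * \<i> * (r * (r * \<tau> + s))) * prime_form \<tau> (r * \<tau> + s)"

lemma klein_form_minus: "klein_form (- r) (- s) \<tau> = - klein_form r s \<tau>"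
  using prime_form_minus[of \<tau> "r * \<tau> + s"] by (simp add: klein_form_def algebra_simps)

text \<open>All \<tau>-dependent exponents cancel, so the factor is constant; for \<open>r\<close>
  and \<open>s\<close> in (1/5)Z it is a tenth root of unity.\<close>

lemma klein_form_shift:
  assumes "Im \<tau> > 0"
  shows "klein_form (r + of_int m) (s + of_int n) \<tau> =
    exp (pi * \<i> * (of_int (m * n + m + n) + r * of_int n - s * of_int m)) * klein_form r s \<tau>"
proof -
  have z: "(r + of_int m) * \<tau> + (s + of_int n) = r * \<tau> + s + of_int m * \<tau> + of_int n"
    by (simp add: algebra_simps)
  show ?thesis
    unfolding klein_form_def z
      quasi_periodic_iterate[of "prime_form \<tau>", OF prime_form_plus_1 prime_form_plus_tau[OF assms]]
      mult.assoc[symmetric] exp_add[symmetric]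
    by (simp add: power2_eq_square algebra_simps)
qed

text \<open>The new parameters are the row vector (r, s) M, chosen so that the point of the
  transformed lattice is \<open>z / j\<close>. The exponents then combine because
  \<open>r + c * z = r' * j\<close>.\<close>

lemma klein_form_modular:
  fixes a b c d :: int
  assumes det: "a * d - b * c = 1" and \<tau>: "Im \<tau> > 0"
  shows "klein_form r s ((of_int a * \<tau> + of_int b) / (of_int c * \<tau> + of_int d)) =
    klein_form (r * of_int a + s * of_int c) (r * of_int b + s * of_int d) \<tau> / (of_int c * \<tau> + of_int d)"
proof -
  define j where "j = of_int c * \<tau> + of_int d"
  define \<tau>' where "\<tau>' = (of_int a * \<tau> + of_int b) / j"
  define r' where "r' = r * of_int a + s * of_int c"
  define s' where "s' = r * of_int b + s * of_int d"
  define z where "z = r' * \<tau> + s'"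
  have j: "j \<noteq> 0"
    unfolding j_def by (rule mobius_denominator_nonzero[OF det \<tau>])
  have cdet: "of_int a * of_int d - of_int b * of_int c = (1 :: complex)"
    using det by (simp flip: of_int_mult of_int_diff)
  have zj: "r * \<tau>' + s = z / j"
    using j by (simp add: \<tau>'_def z_def r'_def s'_def field_simps) (simp add: j_def algebra_simps)
  \<comment> \<open>The summand with \<open>1 - (a * d - b * c)\<close> is zero; it is kept so that
    the identity is purely algebraic and the determinant enters only through
    \<open>cdet\<close>.\<close>
  have "r + of_int c * z = r * (1 - (of_int a * of_int d - of_int b * of_int c)) + r' * j"
    unfolding z_def r'_def s'_def j_def by (simp add: algebra_simps)
  then have rc: "r + of_int c * z = r' * j"
    unfolding cdet by simp
  have "r * (z / j) + of_int c * z\<^sup>2 / j = (r + of_int c * z) * z / j"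
    by (simp add: add_divide_distrib algebra_simps power2_eq_square)
  also have "\<dots> = r' * z"
    unfolding rc using j by simp
  finally have e: "pi * \<i> * (r * (z / j)) + pi * \<i> * of_int c * z\<^sup>2 / j = pi * \<i> * (r' * z)"
    by (simp add: distrib_left[symmetric] mult.assoc times_divide_eq_right[symmetric]
        del: times_divide_eq_right)
  have "klein_form r s \<tau>' = exp (pi * \<i> * (r * (z / j))) * (exp (pi * \<i> * of_int c * z\<^sup>2 / j) / j * prime_form \<tau> z)"
    unfolding klein_form_def zj unfolding \<tau>'_def j_def prime_form_modular[OF det \<tau>] ..
  also have "\<dots> = klein_form r' s' \<tau> / j"
    unfolding klein_form_def z_def[symmetric] e[symmetric] exp_add by simp
  finally show ?thesis
    by (simp add: r'_def s'_def j_def \<tau>'_def)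
qed

section \<open>Theta constants and \<open>G_fun\<close> in terms of Klein forms\<close>

lemma dedekind_eta_power_3:
  "dedekind_eta \<tau> ^ 3 = exp (pi * \<i> * (\<tau> / 4)) * qpoch (nome \<tau>) (nome \<tau>) ^ 3"
proof -
  have "dedekind_eta \<tau> = exp (2 * pi * \<i> * \<tau> / 24) * qpoch (nome \<tau>) (nome \<tau>)"
    by (simp add: dedekind_eta_def qpoch_def nome_def mult.commute)
  moreover have "exp (2 * pi * \<i> * \<tau> / 24) ^ 3 = exp (pi * \<i> * (\<tau> / 4))"
    unfolding exp_of_nat_mult[symmetric] by (simp add: mult_ac)
  ultimately show ?thesis
    by (simp add: power_mult_distrib)
qed

text \<open>Characteristic (1, 1) is the odd theta function, which vanishes at 0; moving the
  characteristic by (-2r, -2s) amounts to evaluating it at r \<tau> + s up to an exponential. Hence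
  the parametrisation.\<close>

lemma theta_char_conv_klein_form:
  fixes r s :: real
  assumes \<tau>: "Im \<tau> > 0"
  shows "theta_char (1 - 2 * r) (1 - 2 * s) 0 \<tau> =
    - exp (pi * \<i> * (1 / 2 - r + r * s)) * dedekind_eta \<tau> ^ 3 * klein_form r s \<tau>"
proof -
  \<comment> \<open>Expanding the square in the theta exponent: \<open>p\<close> collects the part
    quadratic in \<open>n\<close>, \<open>w\<close> the linear part and \<open>C\<close> the
    constant one.\<close>
  define p where "p = exp (pi * \<i> * \<tau>)"
  define w where "w = exp (pi * \<i> * ((1 - 2 * r) * \<tau> + (1 - 2 * s)))"
  define z where "z = r * \<tau> + s"
  define C where "C = exp (pi * \<i> * ((1 - 2 * r)\<^sup>2 * \<tau> / 4 + (1 - 2 * r) * (1 - 2 * s) / 2))"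
  define Q where "Q = qpoch (nome \<tau>) (nome \<tau>)"
  have Q: "Q \<noteq> 0"
    unfolding Q_def by (rule qpoch_self_nonzero[OF norm_nome_less_1[OF \<tau>]])
  have p2: "p\<^sup>2 = nome \<tau>"
    unfolding p_def by (rule half_power)
  have p1: "norm p < 1"
    using \<tau> by (simp add: p_def)
  \<comment> \<open>The sign in the arguments \<open>- p * w\<close> and \<open>- p / w\<close> of
    the triple product is absorbed by the 1 in \<open>1 - 2 * s\<close>.\<close>
  have "nome (\<tau> - z) = exp (- (pi * \<i>)) * (p * w)"
    unfolding nome_def p_def w_def z_def exp_add[symmetric] by (simp add: algebra_simps)
  moreover have "nome z = exp (pi * \<i>) * (p / w)"
    unfolding nome_def p_def w_def z_def exp_add[symmetric] exp_diff[symmetric]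
    by (simp add: algebra_simps)
  ultimately have pw: "- p * w = nome (\<tau> - z)" "- p / w = nome z"
    by (simp_all add: exp_minus)
  have "theta_char (1 - 2 * r) (1 - 2 * s) 0 \<tau> = (\<Sum>\<^sub>\<infinity>n::int. C * (p powi (n\<^sup>2) * w powi n))"
    unfolding theta_char_def
  proof (rule infsum_cong)
    fix n :: int
    show "exp (2 * pi * \<i> * (1 / 2 * (of_int n + of_real (1 - 2 * r) / 2)\<^sup>2 * \<tau> +
        (of_int n + of_real (1 - 2 * r) / 2) * (0 + of_real (1 - 2 * s) / 2))) =
      C * (p powi n\<^sup>2 * w powi n)"
      unfolding C_def p_def w_def exp_power_int exp_add[symmetric]
      by (rule arg_cong[of _ _ exp]) (simp add: field_simps power2_eq_square)
  qed
  also have "\<dots> = C * (\<Sum>\<^sub>\<infinity>n::int. p powi (n\<^sup>2) * w powi n)"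
    by (rule infsum_cmult_right')
  also have "(\<Sum>\<^sub>\<infinity>n::int. p powi (n\<^sup>2) * w powi n) =
      Q * qpoch (nome \<tau>) (nome (\<tau> - z)) * qpoch (nome \<tau>) (nome z)"
    using jacobi_triple_product[OF p1, of w] unfolding p2 pw Q_def by (simp add: p_def w_def)
  also have "C * (Q * qpoch (nome \<tau>) (nome (\<tau> - z)) * qpoch (nome \<tau>) (nome z)) = - (C * exp (pi * \<i> * z)) * Q ^ 3 * prime_form \<tau> z"
  proof -
    have "exp (pi * \<i> * z) * Q ^ 3 * prime_form \<tau> z =
        - (Q * qpoch (nome \<tau>) (nome (\<tau> - z)) * qpoch (nome \<tau>) (nome z))"
      unfolding prime_form_conv_qpoch[OF \<tau>] Q_def[symmetric] using Q
      by (simp add: exp_minus power2_eq_square power3_eq_cube)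
    then show ?thesis
      by (simp add: mult.assoc)
  qed
  \<comment> \<open>The terms in \<open>r * \<tau>\<close> and in \<open>s\<close> alone cancel. Of
    the rest, \<tau> / 4 belongs to eta^3 and \<open>r * (r * \<tau> + s)\<close> to the Klein
    form.\<close>
  also have "C * exp (pi * \<i> * z) =
      exp (pi * \<i> * (1 / 2 - r + r * s)) * exp (pi * \<i> * (\<tau> / 4)) * exp (pi * \<i> * (r * (r * \<tau> + s)))"
    unfolding C_def z_def exp_add[symmetric]
    by (rule arg_cong[of _ _ exp]) (simp add: field_simps power2_eq_square)
  finally show ?thesis
    unfolding dedekind_eta_power_3 klein_form_def z_def Q_def by simp
qed

lemma dedekind_eta_nonzero:
  assumes "Im \<tau> > 0"
  shows "dedekind_eta \<tau> \<noteq> 0"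
  using dedekind_eta_power_3[of \<tau>] qpoch_self_nonzero[OF norm_nome_less_1[OF assms]] by auto

text \<open>The constants 1/2 - r + r s for s = 1/5 and s = -1/5 add up to 3/5, and the two minus
  signs cancel.\<close>

lemma G_fun_conv_klein_form:
  assumes "Im \<tau> > 0"
  shows "G_fun \<tau> = exp (- (3 * pi * \<i> / 5)) / (klein_form (1/5) (1/5) \<tau> * klein_form (1/5) (- 1/5) \<tau>)"
proof -
  define u v where "u = exp (pi * \<i> * (1 / 2 - 1/5 + 1/5 * (1/5)))"
    and "v = exp (pi * \<i> * (1 / 2 - 1/5 + 1/5 * (- 1/5)))"
  have "u * v * exp (- (3 * pi * \<i> / 5)) = 1"
    unfolding u_def v_def exp_add[symmetric] by (simp add: field_simps)
  then have uv: "inverse (u * v) = exp (- (3 * pi * \<i> / 5))"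
    by (metis inverse_unique)
  have t: "theta_char (3/5) (3/5) 0 \<tau> = - u * dedekind_eta \<tau> ^ 3 * klein_form (1/5) (1/5) \<tau>"
     "theta_char (3/5) (7/5) 0 \<tau> = - v * dedekind_eta \<tau> ^ 3 * klein_form (1/5) (- 1/5) \<tau>"
    using theta_char_conv_klein_form[OF assms, of "1/5" "1/5"]
          theta_char_conv_klein_form[OF assms, of "1/5" "- 1/5"]
    by (simp_all add: u_def v_def)
  have "dedekind_eta \<tau> ^ 6 = dedekind_eta \<tau> ^ 3 * dedekind_eta \<tau> ^ 3"
    by (simp flip: power_add)
  then show ?thesis
    unfolding G_fun_def t uv[symmetric] using dedekind_eta_nonzero[OF assms]
    by (simp add: divide_simps u_def v_def)
qed

section \<open>Tenth roots of unity and the multiplier\<close>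

lemma exp_pi_i_fifth_eqI:
  assumes "[m = n] (mod 10)"
  shows "exp (pi * \<i> / 5 * of_int m) = exp (pi * \<i> / 5 * of_int n)"
proof -
  obtain k where "m = n + 10 * k"
    using assms by (metis cong_iff_lin cong_sym)
  then have "exp (pi * \<i> / 5 * of_int m) = exp (pi * \<i> / 5 * of_int n) * exp (2 * of_int k * pi * \<i>)"
    by (simp add: ring_distribs exp_add mult_ac)
  then show ?thesis
    using exp_integer_2pi[of "of_int k"] by simp
qed

text \<open>Reduces the claim to an exponent modulo 10. The Klein forms stand in the denominator,
  which gives the sign in \<open>- e\<close> and turns their two factors \<open>1 / j\<close> into
  \<open>j^2\<close>.\<close>

lemma G_fun_modular:
  fixes a b c d e g :: int
  assumes det: "a * d - b * c = 1" and \<tau>: "Im \<tau> > 0"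
    and K: "klein_form (of_int (a + c) / 5) (of_int (b + d) / 5) \<tau> *
            klein_form (of_int (a - c) / 5) (of_int (b - d) / 5) \<tau> =
            exp (pi * \<i> / 5 * of_int e) * (klein_form (1/5) (1/5) \<tau> * klein_form (1/5) (- 1/5) \<tau>)"
    and g: "g_exp a b c d = of_int g" and eg: "[g = - e] (mod 10)"
  shows "G_fun ((of_int a * \<tau> + of_int b) / (of_int c * \<tau> + of_int d)) =
           nu_G a b c d * (of_int c * \<tau> + of_int d) ^ 2 * G_fun \<tau>"
proof -
  define j where "j = of_int c * \<tau> + of_int d"
  have j: "j \<noteq> 0"
    unfolding j_def by (rule mobius_denominator_nonzero[OF det \<tau>])
  have "nu_G a b c d = exp (pi * \<i> / 5 * of_int (- e))"
    unfolding nu_G_def g using exp_pi_i_fifth_eqI[OF eg] by simp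
  then have nu: "nu_G a b c d = inverse (exp (pi * \<i> / 5 * of_int e))"
    by (simp add: exp_minus)
  have k: "klein_form (1/5) (1/5) ((of_int a * \<tau> + of_int b) / j) =
        klein_form (of_int (a + c) / 5) (of_int (b + d) / 5) \<tau> / j"
    "klein_form (1/5) (- 1/5) ((of_int a * \<tau> + of_int b) / j) =
        klein_form (of_int (a - c) / 5) (of_int (b - d) / 5) \<tau> / j"
    unfolding j_def klein_form_modular[OF det \<tau>] by (simp_all add: add_divide_distrib diff_divide_distrib)
  have "G_fun ((of_int a * \<tau> + of_int b) / j) = exp (- (3 * pi * \<i> / 5)) * j\<^sup>2 /
      (klein_form (of_int (a + c) / 5) (of_int (b + d) / 5) \<tau> *
       klein_form (of_int (a - c) / 5) (of_int (b - d) / 5) \<tau>)"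
    unfolding j_def G_fun_conv_klein_form[OF Im_mobius_pos[OF det \<tau>]]
    unfolding j_def[symmetric] k using j by (simp add: power2_eq_square)
  then show ?thesis
    unfolding K nu G_fun_conv_klein_form[OF \<tau>] j_def[symmetric] by (simp add: field_simps)
qed

theorem mainTheorem9:
  fixes a b c d :: int and \<tau> :: complex
  assumes "in_Gamma_theta5 a b c d" and "Im \<tau> > 0"
  shows "G_fun ((of_int a * \<tau> + of_int b) / (of_int c * \<tau> + of_int d))
           = nu_G a b c d * (of_int c * \<tau> + of_int d) ^ 2 * G_fun \<tau>"
proof -
  note \<tau> = assms(2)
  have det: "a * d - b * c = 1"
    using assms(1) by (simp add: in_Gamma_theta5_def)
  have ex: "\<exists>k. x = y + 5 * k" if "[x = y] (mod 5)" for x y :: int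
    using that by (metis cong_iff_lin cong_sym)
  \<comment> \<open>Measuring exponents in units of pi i / 5 makes the sign -1 equal to
    \<open>E 5\<close>, so signs and shifts are added in the same way.\<close>
  define E :: "int \<Rightarrow> complex" where "E = (\<lambda>x. exp (pi * \<i> / 5 * of_int x))"
  have E_add: "E x * (E y * z) = E (x + y) * z" for x y z
    by (simp add: E_def ring_distribs add_divide_distrib exp_add)
  have E_mult: "(E x * z) * (E y * w) = E (x + y) * (z * w)" for x y z w
    by (simp add: E_def ring_distribs add_divide_distrib exp_add)
  have E5: "- z = E 5 * z" for z
    by (simp add: E_def)
  \<comment> \<open>Five times the exponent of \<open>klein_form_shift\<close> at r = x/5, s =
    y/5.\<close>
  define S :: "int \<Rightarrow> int \<Rightarrow> int \<Rightarrow> int \<Rightarrow> int"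
    where "S = (\<lambda>x y m n. 5 * (m * n + m + n) + x * n - y * m)"
  have shift: "klein_form (of_int (x + 5 * m) / 5) (of_int (y + 5 * n) / 5) \<tau> =
      E (S x y m n) * klein_form (of_int x / 5) (of_int y / 5) \<tau>" for x y m n
    using klein_form_shift[OF \<tau>, of "of_int x / 5" m "of_int y / 5" n]
    by (simp add: E_def S_def add_divide_distrib diff_divide_distrib algebra_simps)
  define K1 K2 where "K1 = klein_form (1/5) (1/5) \<tau>" and "K2 = klein_form (1/5) (- 1/5) \<tau>"
  have K: "klein_form (of_int 1 / 5) (of_int 1 / 5) \<tau> = K1"
     "klein_form (of_int 1 / 5) (of_int (-1) / 5) \<tau> = K2"
     "klein_form (of_int (-1) / 5) (of_int (-1) / 5) \<tau> = E 5 * K1"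
     "klein_form (of_int (-1) / 5) (of_int 1 / 5) \<tau> = E 5 * K2"
    using klein_form_minus[of "1/5" "1/5" \<tau>] klein_form_minus[of "1/5" "-1/5" \<tau>]
    by (simp_all add: K1_def K2_def E5[symmetric])
  have main: ?thesis
    if "g_exp a b c d = of_int g" "[g = - e] (mod 10)"
      and "klein_form (of_int (a + c) / 5) (of_int (b + d) / 5) \<tau> *
           klein_form (of_int (a - c) / 5) (of_int (b - d) / 5) \<tau> = E e * (K1 * K2)" for g e
    using that unfolding E_def K1_def K2_def by (intro G_fun_modular[OF det \<tau>])
  consider
      (1) "[a = 1] (mod 5)" "[b = 0] (mod 5)" "[c = 0] (mod 5)" "[d = 1] (mod 5)"
    | (2) "[a = -1] (mod 5)" "[b = 0] (mod 5)" "[c = 0] (mod 5)" "[d = -1] (mod 5)"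
    | (3) "[a = 0] (mod 5)" "[b = -1] (mod 5)" "[c = 1] (mod 5)" "[d = 0] (mod 5)"
    | (4) "[a = 0] (mod 5)" "[b = 1] (mod 5)" "[c = -1] (mod 5)" "[d = 0] (mod 5)"
    using assms(1) unfolding in_Gamma_theta5_def by blast
  then show ?thesis
  proof cases
    case 1
    obtain a' b' c' d' where e: "a = 1 + 5 * a'" "b = 0 + 5 * b'" "c = 0 + 5 * c'" "d = 1 + 5 * d'"
      using 1[THEN ex] by blast
    \<comment> \<open>The residues are represented by 1 and -1, so that the remaining Klein forms
      are among those listed in \<open>K\<close>.\<close>
    have s: "a + c = 1 + 5 * (a' + c')" "b + d = 1 + 5 * (b' + d')"
      "a - c = 1 + 5 * (a' - c')" "b - d = - 1 + 5 * (b' - d')"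
      by (simp_all add: e)
    have g: "g_exp a b c d = of_int (6 * b' + 2 * a * b' + 2 * c' * d)"
      using 1 by (simp add: g_exp_def cong_def) (simp add: e field_simps)
    \<comment> \<open>Modulo 10 the exponent is 2b' - 2c', and \<open>g\<close> is 8b' + 2c', its
      negative.\<close>
    show ?thesis
    proof (rule main[OF g])
      show "klein_form (of_int (a + c) / 5) (of_int (b + d) / 5) \<tau> *
          klein_form (of_int (a - c) / 5) (of_int (b - d) / 5) \<tau> =
        E (S (1) (1) (a' + c') (b' + d') + (S (1) (- 1) (a' - c') (b' - d'))) * (K1 * K2)"
        unfolding s shift K E_add E_mult by (simp only: mult_ac)
    qed (simp add: cong_iff_dvd_diff e S_def algebra_simps)
  next
    \<comment> \<open>Both vectors change sign here, and 5 + 5 vanishes modulo 10.\<close>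
    case 2
    obtain a' b' c' d' where e: "a = - 1 + 5 * a'" "b = 0 + 5 * b'" "c = 0 + 5 * c'" "d = - 1 + 5 * d'"
      using 2[THEN ex] by blast
    have s: "a + c = - 1 + 5 * (a' + c')" "b + d = - 1 + 5 * (b' + d')"
      "a - c = - 1 + 5 * (a' - c')" "b - d = 1 + 5 * (b' - d')"
      by (simp_all add: e)
    have g: "g_exp a b c d = of_int (24 * b' + 2 * a * b' + 2 * c' * d)"
      using 2 by (simp add: g_exp_def cong_def) (simp add: e field_simps)
    show ?thesis
    proof (rule main[OF g])
      show "klein_form (of_int (a + c) / 5) (of_int (b + d) / 5) \<tau> *
          klein_form (of_int (a - c) / 5) (of_int (b - d) / 5) \<tau> =
        E (S (- 1) (- 1) (a' + c') (b' + d') + 5 + (S (- 1) (1) (a' - c') (b' - d') + 5)) * (K1 * K2)"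
        unfolding s shift K E_add E_mult by (simp only: mult_ac)
    qed (simp add: cong_iff_dvd_diff e S_def algebra_simps)
  next
    \<comment> \<open>The two Klein forms are exchanged and exactly one of them changes sign, whence
      the 5 in \<open>g_exp\<close>; the last case is alike with the other form changing
      sign.\<close>
    case 3
    obtain a' b' c' d' where e: "a = 0 + 5 * a'" "b = - 1 + 5 * b'" "c = 1 + 5 * c'" "d = 0 + 5 * d'"
      using 3[THEN ex] by blast
    have s: "a + c = 1 + 5 * (a' + c')" "b + d = - 1 + 5 * (b' + d')"
      "a - c = - 1 + 5 * (a' - c')" "b - d = - 1 + 5 * (b' - d')"
      by (simp_all add: e)
    have g: "g_exp a b c d = of_int (5 + 6 * d' + 2 * a' * b + 2 * c * d')"
      using 3 by (simp add: g_exp_def cong_def) (simp add: e field_simps)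
    show ?thesis
    proof (rule main[OF g])
      show "klein_form (of_int (a + c) / 5) (of_int (b + d) / 5) \<tau> *
          klein_form (of_int (a - c) / 5) (of_int (b - d) / 5) \<tau> =
        E (S (1) (- 1) (a' + c') (b' + d') + (S (- 1) (- 1) (a' - c') (b' - d') + 5)) * (K1 * K2)"
        unfolding s shift K E_add E_mult by (simp only: mult_ac)
    qed (simp add: cong_iff_dvd_diff e S_def algebra_simps)
  next
    case 4
    obtain a' b' c' d' where e: "a = 0 + 5 * a'" "b = 1 + 5 * b'" "c = - 1 + 5 * c'" "d = 0 + 5 * d'"
      using 4[THEN ex] by blast
    have s: "a + c = - 1 + 5 * (a' + c')" "b + d = 1 + 5 * (b' + d')"
      "a - c = 1 + 5 * (a' - c')" "b - d = 1 + 5 * (b' - d')"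
      by (simp_all add: e)
    have g: "g_exp a b c d = of_int (5 - 6 * d' + 2 * a' * b + 2 * c * d')"
      using 4 by (simp add: g_exp_def cong_def) (simp add: e field_simps)
    show ?thesis
    proof (rule main[OF g])
      show "klein_form (of_int (a + c) / 5) (of_int (b + d) / 5) \<tau> *
          klein_form (of_int (a - c) / 5) (of_int (b - d) / 5) \<tau> =
        E (S (- 1) (1) (a' + c') (b' + d') + 5 + (S (1) (1) (a' - c') (b' - d'))) * (K1 * K2)"
        unfolding s shift K E_add E_mult by (simp only: mult_ac)
    qed (simp add: cong_iff_dvd_diff e S_def algebra_simps)
  qed
qed

end
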